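(* Let $k\ge 5$ and let $G$ be a planar (finite simple) graph with maximum degree $\Delta\le k$ that has no cycles of length 4 and no cycles of length 5. Then $\chi_{gl}''(G)\le k+2$.
   Context: Let $H$ be a graph with an arbitrary fixed orientation and $A$ a group written additively. For $f:E(H)\to A$ and a list assignment $L:V(H)\to 2^A$, an $(A,L,f)$-coloring of $H$ is a map $c:V(H)\to A$ with $c(v)\in L(v)$ for all $v$ and $c(x)-c(y)\neq f(xy)$ for every edge directed from $x$ to $y$. $H$ is $k$-group choosable if for every group $A$ with $|A|\ge k$, every list assignment $L$ with $|L(v)|=k$ for all $v$, and every $f:E(H)\to A$, an $(A,L,f)$-coloring exists; $\chi_{gl}(H)$ is the least such $k$. The total graph $T(G)$ has vertex set $V(G)\cup E(G)$, two elements adjacent iff they are adjacent or incident in $G$; $\chi_{gl}''(G)=\chi_{gl}(T(G))$. *)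

theory Defs
  imports
    "HOL-Analysis.Path_Connected"
    "HOL-Algebra.Group"
    "HOL-Library.Extended_Nat"
begin

record 'a ugraph =
  vertices :: "'a set"
  edges :: "'a set set"

definition finite_simple_graph :: "'a ugraph \<Rightarrow> bool" where
  "finite_simple_graph G \<longleftrightarrow>
     finite (vertices G) \<and> (\<forall>e \<in> edges G. e \<subseteq> vertices G \<and> card e = 2)"

definition degree :: "'a ugraph \<Rightarrow> 'a \<Rightarrow> nat" where
  "degree G v = card {e \<in> edges G. v \<in> e}"

(* On nat, the supremum of a finite nonempty set is its maximum and Sup {} = 0, so the graph
   without vertices has maximum degree 0. *)
definition max_degree :: "'a ugraph \<Rightarrow> nat" where
  "max_degree G = (SUP v \<in> vertices G. degree G v)"

(* Cycles are subgraphs, not necessarily induced, given by the cyclic list of their vertices. *)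
definition is_cycle :: "'a ugraph \<Rightarrow> 'a list \<Rightarrow> bool" where
  "is_cycle G xs \<longleftrightarrow>
     3 \<le> length xs \<and> distinct xs \<and> set xs \<subseteq> vertices G \<and>
     (\<forall>i < length xs. {xs ! i, xs ! ((i + 1) mod length xs)} \<in> edges G)"

definition has_cycle_of_length :: "'a ugraph \<Rightarrow> nat \<Rightarrow> bool" where
  "has_cycle_of_length G n \<longleftrightarrow> (\<exists>xs. is_cycle G xs \<and> length xs = n)"

(* A drawing in the plane: vertices go to distinct points, edges to simple arcs joining their
   ends; an arc meets the vertex points, and the other arcs, only in common end points. *)
definition plane_drawing :: "'a ugraph \<Rightarrow> ('a \<Rightarrow> complex) \<Rightarrow> ('a set \<Rightarrow> real \<Rightarrow> complex) \<Rightarrow> bool" where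
  "plane_drawing G p \<gamma> \<longleftrightarrow>
     inj_on p (vertices G) \<and>
     (\<forall>e \<in> edges G.
        arc (\<gamma> e) \<and>
        {pathstart (\<gamma> e), pathfinish (\<gamma> e)} = p ` e \<and>
        path_image (\<gamma> e) \<inter> p ` vertices G = p ` e) \<and>
     (\<forall>e \<in> edges G. \<forall>e' \<in> edges G. e \<noteq> e' \<longrightarrow>
        path_image (\<gamma> e) \<inter> path_image (\<gamma> e') = p ` (e \<inter> e'))"

definition planar :: "'a ugraph \<Rightarrow> bool" where
  "planar G \<longleftrightarrow> (\<exists>p \<gamma>. plane_drawing G p \<gamma>)"

definition total_graph :: "'a ugraph \<Rightarrow> ('a + 'a set) ugraph" where
  "total_graph G =
     \<lparr> vertices = vertices G <+> edges G,
       edges =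
         {{Inl u, Inl v} | u v. {u, v} \<in> edges G} \<union>
         {{Inl v, Inr e} | v e. e \<in> edges G \<and> v \<in> e} \<union>
         {{Inr e, Inr e'} | e e'. e \<in> edges G \<and> e' \<in> edges G \<and> e \<noteq> e' \<and> e \<inter> e' \<noteq> {}} \<rparr>"

(* The pair (x, y) stands for the edge {x, y} directed from x to y. *)
definition orientation :: "'v ugraph \<Rightarrow> ('v \<times> 'v) set \<Rightarrow> bool" where
  "orientation H D \<longleftrightarrow>
     (\<forall>(x, y) \<in> D. {x, y} \<in> edges H \<and> (y, x) \<notin> D) \<and>
     (\<forall>x y. {x, y} \<in> edges H \<longrightarrow> (x, y) \<in> D \<or> (y, x) \<in> D)"

(* Groups need not be commutative. In multiplicative notation c x - c y is
   c x \<otimes> inv (c y). *)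
definition group_coloring ::
  "'v ugraph \<Rightarrow> ('v \<times> 'v) set \<Rightarrow> ('g, 'm) monoid_scheme \<Rightarrow> ('v \<Rightarrow> 'g set) \<Rightarrow> ('v set \<Rightarrow> 'g) \<Rightarrow>
   ('v \<Rightarrow> 'g) \<Rightarrow> bool" where
  "group_coloring H D A L f c \<longleftrightarrow>
     (\<forall>v \<in> vertices H. c v \<in> carrier A \<and> c v \<in> L v) \<and>
     (\<forall>(x, y) \<in> D. c x \<otimes>\<^bsub>A\<^esub> inv\<^bsub>A\<^esub> c y \<noteq> f {x, y})"

(* Quantification over all groups is split in two: over all groups whose carrier is a subset
   of the type 'g, here, and over 'g, by type polymorphism of the theorems. Infinite groups
   are included, although card maps them to 0. Every orientation is allowed; the choice is
   immaterial, since reversing an edge amounts to inverting its f-value. *)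
definition group_choosable :: "'g itself \<Rightarrow> 'v ugraph \<Rightarrow> nat \<Rightarrow> bool" where
  "group_choosable T H k \<longleftrightarrow>
     (\<forall>(A :: 'g monoid) D L f.
        group A \<and> (finite (carrier A) \<longrightarrow> k \<le> card (carrier A)) \<and>
        orientation H D \<and>
        (\<forall>v \<in> vertices H. L v \<subseteq> carrier A \<and> finite (L v) \<and> card (L v) = k) \<and>
        (\<forall>e \<in> edges H. f e \<in> carrier A) \<longrightarrow>
        (\<exists>c. group_coloring H D A L f c))"

(* The least such k, and infinity if there is none. *)
definition group_choice_number :: "'g itself \<Rightarrow> 'v ugraph \<Rightarrow> enat" where
  "group_choice_number T H = Inf (enat ` {k. group_choosable T H k})"

definition total_group_choice_number :: "'g itself \<Rightarrow> 'a ugraph \<Rightarrow> enat" where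
  "total_group_choice_number T G = group_choice_number T (total_graph G)"

lemma group_choosable_mono:
  fixes T :: "'g itself" and H :: "'v ugraph"
  assumes "group_choosable T H k" "k \<le> n"
  shows "group_choosable T H n"
  unfolding group_choosable_def
proof (intro allI impI, elim conjE)
  fix A :: "'g monoid" and D L f
  assume A: "group A" "finite (carrier A) \<longrightarrow> n \<le> card (carrier A)" "orientation H D"
    and L: "\<forall>v \<in> vertices H. L v \<subseteq> carrier A \<and> finite (L v) \<and> card (L v) = n"
    and f: "\<forall>e \<in> edges H. f e \<in> carrier A"
  have "\<exists>S. S \<subseteq> L v \<and> finite S \<and> card S = k" if "v \<in> vertices H" for v
    using L that \<open>k \<le> n\<close> by (metis obtain_subset_with_card_n)
  then obtain M where M: "M v \<subseteq> L v \<and> finite (M v) \<and> card (M v) = k" if "v \<in> vertices H" for v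
    by metis
  have "\<forall>v \<in> vertices H. M v \<subseteq> carrier A \<and> finite (M v) \<and> card (M v) = k"
    using M L by blast
  moreover have "finite (carrier A) \<longrightarrow> k \<le> card (carrier A)"
    using A(2) \<open>k \<le> n\<close> by linarith
  ultimately obtain c where "group_coloring H D A M f c"
    using assms(1) A f unfolding group_choosable_def by blast
  then have "group_coloring H D A L f c"
    using M unfolding group_coloring_def by blast
  then show "\<exists>c. group_coloring H D A L f c" by blast
qed

lemma group_choice_number_le_iff:
  "group_choice_number T H \<le> enat n \<longleftrightarrow> group_choosable T H n"
proof
  assume le: "group_choice_number T H \<le> enat n"
  then have "enat ` {k. group_choosable T H k} \<noteq> {}"
    unfolding group_choice_number_def by (metis Inf_empty enat_ord_simps(5) infinity_ileE top_enat_def)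
  then have "group_choice_number T H \<in> enat ` {k. group_choosable T H k}"
    unfolding group_choice_number_def by (metis Inf_enat_def LeastI all_not_in_conv)
  then obtain k where "group_choosable T H k" "group_choice_number T H = enat k"
    by blast
  then show "group_choosable T H n"
    using le group_choosable_mono by fastforce
next
  assume "group_choosable T H n"
  then show "group_choice_number T H \<le> enat n"
    unfolding group_choice_number_def by (intro Inf_lower) blast
qed

end

theory Submission
  imports Defs "HOL-Analysis.Jordan_Curve"
begin

text \<open>In a planar graph with \<open>n\<close> vertices, \<open>m\<close> edges, \<open>t\<close> triangles and no cycle of length 4 or 5, faces have
  length 3 or at least 6, so Euler's formula yields \<open>4 m < 6 n + 3 t\<close>. This is obtained without counting
  faces: for a cycle \<open>C\<close> of length \<open>l\<close> in a 2-connected plane graph and a side \<open>D\<close> of it with \<open>m\<close> edges and \<open>n\<close>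
  vertices in \<open>D\<close> and \<open>t\<close> triangles in its closure, \<open>4 m \<le> 6 n + 3 t + l - 6\<close> follows by induction on \<open>m\<close>, a chord cutting \<open>D\<close> into
  sides of two cycles of total length \<open>l\<close> plus twice that of the chord; add up the two sides of one cycle.
  Discharging against this bound gives an edge \<open>uv\<close> with \<open>d(u) \<le> 3\<close> and \<open>d(u) + d(v) \<le> k + 2\<close>. Remove it,
  colour the rest by induction, then colour \<open>uv\<close> ignoring \<open>u\<close>, and recolour \<open>u\<close>, which has at most \<open>6 \<le> k + 1\<close>
  neighbours in the total graph.\<close>

section \<open>Sides of a simple closed curve\<close>

text \<open>Arcs are kept as point sets, without a parametrisation, so that joining and intersecting
  drawn paths are plain set operations and the ends can be swapped.\<close>

definition arc_between :: "complex set \<Rightarrow> complex \<Rightarrow> complex \<Rightarrow> bool" where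
  "arc_between S a b \<longleftrightarrow>
     (\<exists>g. arc g \<and> pathstart g = a \<and> pathfinish g = b \<and> path_image g = S)"

lemma arc_between_sym: "arc_between S a b \<Longrightarrow> arc_between S b a"
  unfolding arc_between_def
  by (metis arc_reversepath path_image_reversepath pathfinish_reversepath pathstart_reversepath)

lemma arc_betweenD:
  assumes "arc_between S a b"
  shows "compact S" "connected S" "a \<noteq> b" "a \<in> S" "b \<in> S"
    "connected (S - {a, b})" "S - {a, b} \<noteq> {}"
proof -
  obtain g where g: "arc g" "pathstart g = a" "pathfinish g = b" "path_image g = S"
    using assms unfolding arc_between_def by blast
  then have s: "simple_path g" by (simp add: arc_imp_simple_path)
  show "compact S" "connected S" "a \<noteq> b"
    using g by (auto simp: compact_arc_image arc_imp_path connected_path_image dest: arc_distinct_ends)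
  show "a \<in> S" "b \<in> S" using g by auto
  show "connected (S - {a, b})" using connected_simple_path_endless[OF s] g by simp
  show "S - {a, b} \<noteq> {}" using nonempty_simple_path_endless[OF s] g by simp
qed

lemma arc_between_join:
  assumes "arc_between S a b" "arc_between T b c" "S \<inter> T \<subseteq> {b}"
  shows "arc_between (S \<union> T) a c"
proof -
  obtain g where g: "arc g" "pathstart g = a" "pathfinish g = b" "path_image g = S"
    using assms unfolding arc_between_def by blast
  obtain h where h: "arc h" "pathstart h = b" "pathfinish h = c" "path_image h = T"
    using assms unfolding arc_between_def by blast
  have "arc (g +++ h)" using g h assms by (intro arc_join) auto
  moreover have "path_image (g +++ h) = S \<union> T" using g h by (simp add: path_image_join)
  ultimately show ?thesis unfolding arc_between_def using g h by (metis pathfinish_join pathstart_join)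
qed

text \<open>For edges with one end possibly on a curve and the rest off it. The set is the image of
  \<open>[0, 1)\<close> under the arc.\<close>

lemma arc_between_half_open:
  assumes "arc_between S a b"
  shows "connected (S - {b})"
proof -
  obtain g where g: "arc g" "pathstart g = a" "pathfinish g = b" "path_image g = S"
    using assms unfolding arc_between_def by blast
  have inj: "inj_on g {0..1}" and cont: "continuous_on {0..1} g"
    using g(1) by (auto simp: arc_def path_def)
  have "g ` ({0..1} - {1}) = g ` {0..1} - g ` {1}"
    by (rule inj_on_image_set_diff[OF inj]) auto
  moreover have "{0..1} - {1} = {0..<1::real}" by auto
  ultimately have "S - {b} = g ` {0..<1}"
    using g by (simp add: path_image_def pathfinish_def)
  moreover have "connected (g ` {0..<1})"
    by (rule connected_continuous_image) (auto intro: continuous_on_subset[OF cont])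
  ultimately show ?thesis by simp
qed

text \<open>The conclusion of the Jordan curve theorem without boundedness: the two sides are
  interchangeable, and the outer region gets no special treatment.\<close>

definition sides :: "complex set \<Rightarrow> complex set \<Rightarrow> complex set \<Rightarrow> bool" where
  "sides K D E \<longleftrightarrow>
     D \<noteq> {} \<and> E \<noteq> {} \<and> open D \<and> open E \<and> connected D \<and> connected E \<and>
     D \<inter> E = {} \<and> D \<union> E = - K \<and> frontier D = K \<and> frontier E = K"

lemma sides_sym: "sides K D E \<Longrightarrow> sides K E D"
  unfolding sides_def by blast

lemma sides_disjoint: "sides K D E \<Longrightarrow> D \<inter> E = {}" "sides K D E \<Longrightarrow> D \<inter> K = {}"
  unfolding sides_def by blast+

lemma sides_connected_cases:
  assumes "sides K D E" "connected X" "X \<inter> K = {}"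
  shows "X \<subseteq> D \<or> X \<subseteq> E"
proof -
  have "X \<subseteq> D \<union> E" using assms unfolding sides_def by blast
  moreover have "D \<inter> X = {} \<or> E \<inter> X = {}"
    using assms connectedD[OF assms(2), of D E] unfolding sides_def by blast
  ultimately show ?thesis by blast
qed

lemma sides_exist:
  assumes A: "arc_between A a b" and B: "arc_between B a b" and AB: "A \<inter> B \<subseteq> {a, b}"
  shows "\<exists>D E. sides (A \<union> B) D E"
proof -
  obtain g where g: "arc g" "pathstart g = a" "pathfinish g = b" "path_image g = A"
    using A unfolding arc_between_def by blast
  obtain h where h: "arc h" "pathstart h = b" "pathfinish h = a" "path_image h = B"
    using arc_between_sym[OF B] unfolding arc_between_def by blast
  have s: "simple_path (g +++ h)"
    using g h AB by (intro simple_path_join_loop) auto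
  have im: "path_image (g +++ h) = A \<union> B" using g h by (simp add: path_image_join)
  have "pathfinish (g +++ h) = pathstart (g +++ h)" using g h by simp
  from Jordan_curve[OF s this] show ?thesis
    unfolding im sides_def by metis
qed

text \<open>Janiszewski's theorem rules out a third region of \<open>D\<close> minus the chord: a point of it would be
  joined to the opposite side outside both \<open>A \<union> Q\<close> and \<open>B \<union> Q\<close>, whose intersection is \<open>Q\<close>.\<close>

lemma sides_split:
  assumes A: "arc_between A a b" and B: "arc_between B a b" and Q: "arc_between Q a b"
    and AB: "A \<inter> B \<subseteq> {a, b}" and K: "sides (A \<union> B) D E" and QD: "Q - {a, b} \<subseteq> D"
  obtains D1 E1 D2 E2 where "sides (A \<union> Q) D1 E1" "sides (B \<union> Q) D2 E2"
    "D1 \<inter> D2 = {}" "D = D1 \<union> D2 \<union> (Q - {a, b})"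
proof -
  note Kd = K[unfolded sides_def]
  have ends: "a \<in> A" "b \<in> A" "a \<in> B" "b \<in> B" "a \<in> Q" "b \<in> Q"
    using arc_betweenD A B Q by blast+
  have AQ: "A \<inter> Q \<subseteq> {a, b}" and BQ: "B \<inter> Q \<subseteq> {a, b}" using QD Kd by blast+
  have cl: "closure E = E \<union> (A \<union> B)" using Kd closure_Un_frontier[of E] by metis
  \<comment> \<open>A connected set stays connected when points of its closure are added, and the
    whole curve is the frontier of \<open>E\<close>.\<close>
  have conn: "connected (E \<union> (X - {a, b}))" if "arc_between X a b" "X \<subseteq> A \<union> B" for X
  proof (rule connected_intermediate_closure)
    show "connected E" using Kd by blast
    show "E \<union> (X - {a, b}) \<subseteq> closure E" using cl that by blast
  qed auto
  \<comment> \<open>\<open>E'\<close> is the far side of the new curve: it absorbs the old opposite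
    side \<open>E\<close> together with the open arc of \<open>Y\<close> left out of the new
    curve.\<close>
  have far: "\<exists>D' E'. sides (X \<union> Q) D' E' \<and> E \<union> (Y - {a, b}) \<subseteq> E'"
    if X: "arc_between X a b" and Y: "arc_between Y a b" and XY: "X \<union> Y = A \<union> B" "X \<inter> Y \<subseteq> {a, b}"
      "X \<inter> Q \<subseteq> {a, b}" "Y \<inter> Q \<subseteq> {a, b}" for X Y
  proof -
    obtain D' E' where s: "sides (X \<union> Q) D' E'" using sides_exist[OF X Q] XY by blast
    have cE: "connected (E \<union> (Y - {a, b}))" using conn[OF Y] XY by blast
    have "E \<inter> (X \<union> Q) = {}"
    proof -
      have "E \<inter> (A \<union> B) = {}" using Kd by blast
      moreover have "Q \<subseteq> D \<union> A" using QD ends by blast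
      moreover have "D \<inter> E = {}" using Kd by blast
      ultimately show ?thesis using XY(1) by blast
    qed
    then have "(E \<union> (Y - {a, b})) \<inter> (X \<union> Q) = {}" using XY(2-4) by blast
    then have "E \<union> (Y - {a, b}) \<subseteq> D' \<or> E \<union> (Y - {a, b}) \<subseteq> E'"
      by (rule sides_connected_cases[OF s cE])
    then show ?thesis using s sides_sym by blast
  qed
  obtain D1 E1 where s1: "sides (A \<union> Q) D1 E1" and e1: "E \<union> (B - {a, b}) \<subseteq> E1"
    using far[OF A B] AB AQ BQ by blast
  obtain D2 E2 where s2: "sides (B \<union> Q) D2 E2" and e2: "E \<union> (A - {a, b}) \<subseteq> E2"
    using far[OF B A] AB AQ BQ by (auto simp: Un_commute Int_commute)
  note d1 = s1[unfolded sides_def] and d2 = s2[unfolded sides_def]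
  have DE: "D \<union> E = - (A \<union> B)" "D \<inter> E = {}" using Kd by blast+
  have DE1: "D1 \<union> E1 = - (A \<union> Q)" "D1 \<inter> E1 = {}" using d1 by blast+
  have DE2: "D2 \<union> E2 = - (B \<union> Q)" "D2 \<inter> E2 = {}" using d2 by blast+
  have D1: "D1 \<subseteq> D - Q" using e1 DE DE1 ends by blast
  have D2: "D2 \<subseteq> D - Q" using e2 DE DE2 ends by blast
  have "D1 \<subseteq> D2 \<or> D1 \<subseteq> E2"
    by (rule sides_connected_cases[OF s2]) (use d1 in blast, use D1 DE in blast)
  moreover have "D2 \<subseteq> D1 \<or> D2 \<subseteq> E1"
    by (rule sides_connected_cases[OF s1]) (use d2 in blast, use D2 DE in blast)
  \<comment> \<open>Equal regions would have equal frontiers, and then the open arc of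
    \<open>A\<close> would lie in \<open>B \<union> Q\<close>, which it misses. Every other
    combination of the inclusions above gives disjointness.\<close>
  moreover have "D1 \<noteq> D2"
  proof
    assume "D1 = D2"
    then have "A \<union> Q = B \<union> Q" using d1 d2 by metis
    then show False using arc_betweenD(7)[OF A] AB AQ by blast
  qed
  ultimately have disj: "D1 \<inter> D2 = {}" using DE1 DE2 by blast
  have "x \<in> D1 \<union> D2 \<union> (Q - {a, b})" if x: "x \<in> D" for x
  proof (rule ccontr)
    assume "x \<notin> D1 \<union> D2 \<union> (Q - {a, b})"
    then have xE: "x \<in> E1" "x \<in> E2" using x DE DE1 DE2 ends by blast+
    obtain e where e: "e \<in> E" using Kd by blast
    have eE: "e \<in> E1" "e \<in> E2" using e e1 e2 by blast+
    have "connected_component (- ((A \<union> Q) \<union> (B \<union> Q))) x e"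
    proof (rule Janiszewski)
      show "compact (A \<union> Q)" using arc_betweenD(1) A Q by blast
      show "closed (B \<union> Q)" using arc_betweenD(1) B Q compact_imp_closed by blast
      have "(A \<union> Q) \<inter> (B \<union> Q) = Q" using AB ends by blast
      then show "connected ((A \<union> Q) \<inter> (B \<union> Q))" using arc_betweenD(2)[OF Q] by simp
      show "connected_component (- (A \<union> Q)) x e"
        unfolding connected_component_def
        by (rule exI[of _ E1]) (use DE1 d1 xE eE in auto)
      show "connected_component (- (B \<union> Q)) x e"
        unfolding connected_component_def
        by (rule exI[of _ E2]) (use DE2 d2 xE eE in auto)
    qed
    then obtain X where X: "connected X" "X \<subseteq> - (A \<union> Q \<union> (B \<union> Q))" "x \<in> X" "e \<in> X"
      unfolding connected_component_def by blast
    then have "X \<subseteq> D \<or> X \<subseteq> E" by (intro sides_connected_cases[OF K]) auto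
    then show False using X(3,4) x e DE(2) by blast
  qed
  then have "D = D1 \<union> D2 \<union> (Q - {a, b})" using D1 D2 QD by blast
  then show ?thesis using that s1 s2 disj by blast
qed

section \<open>Paths and cycles as lists\<close>

fun path_edges :: "'a list \<Rightarrow> 'a set set" where
  "path_edges (x # y # zs) = insert {x, y} (path_edges (y # zs))"
| "path_edges _ = {}"

text \<open>The list is closed up by its head. For the empty list the unspecified head is harmless,
  since a one-element list has no edges; for two entries the two edges coincide, hence the bound 3
  where edges are counted.\<close>

definition cycle_edges :: "'a list \<Rightarrow> 'a set set" where
  "cycle_edges xs = path_edges (xs @ [hd xs])"

text \<open>A triangle is its vertex set, and membership depends on an edge set alone. So triangles
  can be taken in the closure of a side, and intersecting edge sets intersects their sets of
  triangles.\<close>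

definition triangles :: "'a set set \<Rightarrow> 'a set set" where
  "triangles F = {S. card S = 3 \<and> (\<forall>e. e \<subseteq> S \<and> card e = 2 \<longrightarrow> e \<in> F)}"

lemma finite_path_edges [simp]: "finite (path_edges xs)"
  by (induction xs rule: path_edges.induct) auto

lemma path_edges_append: "path_edges (us @ b # vs) = path_edges (us @ [b]) \<union> path_edges (b # vs)"
proof (induction us)
  case (Cons u us)
  then show ?case by (cases us) auto
qed simp

lemma path_edges_snoc: "ws \<noteq> [] \<Longrightarrow> path_edges (ws @ [b]) = insert {last ws, b} (path_edges ws)"
proof -
  assume "ws \<noteq> []"
  then obtain zs z where "ws = zs @ [z]" by (metis rev_exhaust)
  then show ?thesis using path_edges_append[of zs z "[b]"] by auto
qed

lemma path_edges_rev: "path_edges (rev xs) = path_edges xs"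
proof (induction xs rule: path_edges.induct)
  case (1 x y zs)
  then show ?case using path_edges_append[of "rev zs" y "[x]"] by auto
qed auto

lemma Union_path_edges_subset: "\<Union>(path_edges xs) \<subseteq> set xs"
  by (induction xs rule: path_edges.induct) auto

lemma Union_path_edges: "2 \<le> length xs \<Longrightarrow> \<Union>(path_edges xs) = set xs"
proof (induction xs rule: path_edges.induct)
  case (1 x y zs)
  then show ?case by (cases zs) auto
qed auto

lemma card_path_edges: "distinct xs \<Longrightarrow> card (path_edges xs) = length xs - 1"
proof (induction xs rule: path_edges.induct)
  case (1 x y zs)
  then have "{x, y} \<notin> path_edges (y # zs)" using Union_path_edges_subset[of "y # zs"] by auto
  then show ?case using 1 by simp
qed auto

lemma path_edges_nth: "Suc i < length xs \<Longrightarrow> {xs ! i, xs ! Suc i} \<in> path_edges xs"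
proof (induction xs arbitrary: i rule: path_edges.induct)
  case (1 x y zs)
  then show ?case by (cases i) auto
qed auto

section \<open>Triangles in edge sets\<close>

lemma triangles_mono: "F \<subseteq> F' \<Longrightarrow> triangles F \<subseteq> triangles F'"
  unfolding triangles_def by blast

lemma triangles_Int: "triangles F \<inter> triangles F' = triangles (F \<inter> F')"
  unfolding triangles_def by blast

lemma triangle_other_edges:
  assumes "S \<in> triangles F" "x \<in> S"
  obtains y z where "y \<noteq> z" "x \<noteq> y" "x \<noteq> z" "S = {x, y, z}" "{x, y} \<in> F" "{x, z} \<in> F" "{y, z} \<in> F"
proof -
  have "card S = 3" using assms unfolding triangles_def by blast
  then have "card (S - {x}) = 2" using assms by simp
  then obtain y z where yz: "S - {x} = {y, z}" "y \<noteq> z" by (auto simp: card_2_iff)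
  then have S: "S = {x, y, z}" "x \<noteq> y" "x \<noteq> z" using assms by auto
  have "e \<in> F" if "e \<subseteq> S" "card e = 2" for e using assms that unfolding triangles_def by blast
  then have "{x, y} \<in> F" "{x, z} \<in> F" "{y, z} \<in> F" using S yz(2) by auto
  then show ?thesis using that S yz(2) by blast
qed

lemma triangles_subset_Union: "S \<in> triangles F \<Longrightarrow> S \<subseteq> \<Union>F"
proof
  fix x assume S: "S \<in> triangles F" and "x \<in> S"
  then obtain y where "{x, y} \<in> F" by (rule triangle_other_edges)
  then show "x \<in> \<Union>F" by blast
qed

lemma triangles_empty: "triangles {} = {}"
proof -
  have "S = {}" if "S \<in> triangles {}" for S using triangles_subset_Union[OF that] by simp
  moreover have "{} \<notin> triangles {}" unfolding triangles_def by simp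
  ultimately show ?thesis by blast
qed

lemma finite_triangles:
  assumes "finite (\<Union>F)"
  shows "finite (triangles F)"
proof (rule finite_subset)
  show "triangles F \<subseteq> Pow (\<Union>F)" using triangles_subset_Union by fast
qed (use assms in simp)

text \<open>The first vertex of a path has only one edge, while a triangle has two at each of its
  vertices. So no triangle contains the first vertex, and it can be peeled off.\<close>

lemma triangles_path_edges: "distinct xs \<Longrightarrow> triangles (path_edges xs) = {}"
proof (induction xs rule: path_edges.induct)
  case (1 x y zs)
  have x: "x \<notin> \<Union>(path_edges (y # zs))" using 1 Union_path_edges_subset[of "y # zs"] by auto
  have "S \<in> triangles (path_edges (y # zs))" if S: "S \<in> triangles (path_edges (x # y # zs))" for S
  proof -
    have "x \<notin> S"
    proof
      assume "x \<in> S"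
      obtain u v where "u \<noteq> v" and uv: "{x, u} \<in> path_edges (x # y # zs)" "{x, v} \<in> path_edges (x # y # zs)"
        by (rule triangle_other_edges[OF S \<open>x \<in> S\<close>])
      have "{x, w} \<notin> path_edges (y # zs)" for w using x by blast
      then have "{x, u} = {x, y}" "{x, v} = {x, y}" using uv by simp_all
      then show False using \<open>u \<noteq> v\<close> by (metis doubleton_eq_iff)
    qed
    then show ?thesis using S unfolding triangles_def by auto
  qed
  then show ?case using 1 by auto
qed (simp_all add: triangles_empty)

section \<open>Cycles cut into two paths\<close>

lemma cycle_edges_split:
  "cycle_edges (a # us @ b # vs) = path_edges (a # us @ [b]) \<union> path_edges (b # vs @ [a])"
  using path_edges_append[of "a # us" b "vs @ [a]"] by (simp add: cycle_edges_def)

lemma cycle_edges_rotate: "cycle_edges (us @ vs) = cycle_edges (vs @ us)"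
proof (cases "us = [] \<or> vs = []")
  case False
  then obtain a us' b vs' where "us = a # us'" "vs = b # vs'" by (meson neq_Nil_conv)
  then show ?thesis using cycle_edges_split[of a us' b vs'] cycle_edges_split[of b vs' a us'] by auto
qed auto

lemma Union_cycle_edges: "2 \<le> length xs \<Longrightarrow> \<Union>(cycle_edges xs) = set xs"
  unfolding cycle_edges_def by (subst Union_path_edges) (cases xs; auto)+

lemma cycle_at:
  assumes "distinct xs" "a \<in> set xs"
  obtains us where "distinct (a # us)" "set (a # us) = set xs" "length (a # us) = length xs"
    "cycle_edges (a # us) = cycle_edges xs"
proof -
  obtain ps qs where xs: "xs = ps @ a # qs" using assms by (meson split_list)
  show ?thesis
    by (rule that[of "qs @ ps"]) (use assms xs cycle_edges_rotate[of ps "a # qs"] in auto)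
qed

text \<open>Rotation brings a cycle into the form in which two chosen vertices are visible, so that
  \<open>cycle_edges_split\<close> reads off the two paths between them.\<close>

lemma cycle_at2:
  assumes "distinct xs" "a \<in> set xs" "b \<in> set xs" "a \<noteq> b"
  obtains us vs where "distinct (a # us @ b # vs)" "set (a # us @ b # vs) = set xs"
    "length (a # us @ b # vs) = length xs" "cycle_edges (a # us @ b # vs) = cycle_edges xs"
proof -
  obtain ys where ys: "distinct (a # ys)" "set (a # ys) = set xs" "length (a # ys) = length xs"
    "cycle_edges (a # ys) = cycle_edges xs" using cycle_at assms by metis
  then have "b \<in> set ys" using assms by auto
  then obtain us vs where "ys = us @ b # vs" by (meson split_list)
  then show ?thesis using that[of us vs] ys by simp
qed

lemma card_cycle_edges:
  assumes "distinct xs" "3 \<le> length xs"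
  shows "card (cycle_edges xs) = length xs"
proof -
  obtain a b c zs where xs: "xs = a # b # c # zs" using assms(2)
    by (metis Suc_le_length_iff numeral_3_eq_3)
  have d: "distinct (b # c # zs @ [a])" using assms xs by auto
  have "b \<notin> \<Union>(path_edges (c # zs @ [a]))"
    using d Union_path_edges_subset[of "c # zs @ [a]"] by auto
  then have "{a, b} \<notin> path_edges (b # c # zs @ [a])" using d by (auto simp: doubleton_eq_iff)
  moreover have "card (path_edges (b # c # zs @ [a])) = length xs - 1"
    using card_path_edges[OF d] xs by simp
  ultimately show ?thesis using xs by (simp add: cycle_edges_def)
qed

text \<open>By counting: the two paths have \<open>length us + 1\<close> and
  \<open>length vs + 1\<close> edges, and these add up to the number of edges of the cycle, which
  leaves no room for a common edge.\<close>

lemma cycle_split_disjoint: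
  assumes "distinct (a # us @ b # vs)" "3 \<le> length (a # us @ b # vs)"
  shows "path_edges (a # us @ [b]) \<inter> path_edges (b # vs @ [a]) = {}"
proof -
  let ?A = "path_edges (a # us @ [b])" and ?B = "path_edges (b # vs @ [a])"
  have "card ?A = length us + 1" "card ?B = length vs + 1"
    using assms by (subst card_path_edges; auto)+
  moreover have "card (?A \<union> ?B) = length us + length vs + 2"
    using card_cycle_edges[OF assms] by (simp add: cycle_edges_split)
  ultimately have "card (?A \<inter> ?B) = 0" using card_Un_Int[of ?A ?B] by simp
  then show ?thesis by simp
qed

text \<open>If a triangle missed a vertex \<open>x\<close> of the cycle, its edges would all lie in
  the path left after deleting \<open>x\<close>. This leaves the vertex set of the cycle as the only
  candidate for a triangle among its own edges.\<close>

lemma triangle_in_cycle: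
  assumes "distinct xs" "S \<in> triangles (cycle_edges xs)"
  shows "set xs \<subseteq> S"
proof
  fix x assume "x \<in> set xs"
  then obtain us where us: "distinct (x # us)" "cycle_edges (x # us) = cycle_edges xs"
    using cycle_at assms by metis
  show "x \<in> S"
  proof (rule ccontr)
    assume xS: "x \<notin> S"
    have sub: "cycle_edges (x # us) \<subseteq> path_edges us \<union> {e. x \<in> e}"
    proof (cases us)
      case (Cons y ys)
      have "cycle_edges (x # us) = insert {x, y} (path_edges (us @ [x]))"
        using Cons by (simp add: cycle_edges_def)
      moreover have "path_edges (us @ [x]) \<subseteq> path_edges us \<union> {e. x \<in> e}"
        using Cons path_edges_snoc[of us x] by auto
      ultimately show ?thesis by auto
    qed (auto simp: cycle_edges_def)
    have "e \<in> path_edges us" if "e \<subseteq> S" "card e = 2" for e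
      using assms(2) sub that xS us(2) unfolding triangles_def by blast
    then have "S \<in> triangles (path_edges us)" using assms(2) unfolding triangles_def by blast
    then show False using triangles_path_edges[of us] us(1) by auto
  qed
qed

lemma is_cycleI:
  assumes G: "finite_simple_graph G" and xs: "distinct xs" "3 \<le> length xs" "cycle_edges xs \<subseteq> edges G"
  shows "is_cycle G xs"
proof -
  have "xs \<noteq> []" using xs by auto
  have "{xs ! i, xs ! ((i + 1) mod length xs)} \<in> edges G" if i: "i < length xs" for i
  proof -
    have "{(xs @ [hd xs]) ! i, (xs @ [hd xs]) ! Suc i} \<in> cycle_edges xs"
      unfolding cycle_edges_def by (rule path_edges_nth) (use i in simp)
    \<comment> \<open>At the last index the appended head plays the role of the index
      \<open>0\<close> produced by \<open>mod\<close>.\<close>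
    moreover have "(xs @ [hd xs]) ! Suc i = xs ! ((i + 1) mod length xs)"
      using i \<open>xs \<noteq> []\<close> by (cases "Suc i = length xs") (auto simp: nth_append hd_conv_nth)
    ultimately show ?thesis using xs(3) i by (auto simp: nth_append)
  qed
  moreover have "set xs \<subseteq> vertices G"
    using Union_cycle_edges[of xs] xs G unfolding finite_simple_graph_def by fastforce
  ultimately show ?thesis using xs unfolding is_cycle_def by blast
qed

section \<open>Reachability in 2-connected graphs\<close>

text \<open>For finite simple graphs with at least three vertices this says: connected and without cut vertex.\<close>

definition nonseparable :: "'a ugraph \<Rightarrow> bool" where
  "nonseparable G \<longleftrightarrow>
     (\<forall>S \<subseteq> vertices G. S \<noteq> {} \<longrightarrow> 2 \<le> card (vertices G - S) \<longrightarrow>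
       (\<exists>a b. a \<noteq> b \<and> a \<in> vertices G - S \<and> b \<in> vertices G - S \<and>
          (\<exists>s \<in> S. {a, s} \<in> edges G) \<and> (\<exists>s \<in> S. {b, s} \<in> edges G)))"

text \<open>The reflexive transitive closure takes a vertex outside \<open>X\<close> to its
  component after deletion of \<open>X\<close>; a vertex of \<open>X\<close> reaches only
  itself.\<close>

definition avoiding :: "'a set set \<Rightarrow> 'a set \<Rightarrow> ('a \<times> 'a) set" where
  "avoiding E X = {(y, z). {y, z} \<in> E \<and> y \<notin> X \<and> z \<notin> X}"

lemma rtrancl_avoiding_sym: "(x, y) \<in> (avoiding E X)\<^sup>* \<Longrightarrow> (y, x) \<in> (avoiding E X)\<^sup>*"
proof -
  have "sym (avoiding E X)" by (auto simp: avoiding_def sym_def insert_commute)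
  then show "(x, y) \<in> (avoiding E X)\<^sup>* \<Longrightarrow> (y, x) \<in> (avoiding E X)\<^sup>*"
    by (meson sym_rtrancl symD)
qed

text \<open>A walk is built edge by edge; when it returns to an earlier vertex, the list is cut off
  there, which keeps it distinct.\<close>

lemma avoiding_path:
  assumes "(x, y) \<in> (avoiding E X)\<^sup>*"
  shows "\<exists>ws. distinct ws \<and> ws \<noteq> [] \<and> hd ws = x \<and> last ws = y \<and>
    set ws \<subseteq> (avoiding E X)\<^sup>* `` {x} \<and> path_edges ws \<subseteq> E"
  using assms
proof (induction rule: rtrancl_induct)
  case base
  show ?case by (rule exI[of _ "[x]"]) auto
next
  case (step y z)
  then obtain ws where ws: "distinct ws" "ws \<noteq> []" "hd ws = x" "last ws = y"
    "set ws \<subseteq> (avoiding E X)\<^sup>* `` {x}" "path_edges ws \<subseteq> E" by blast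
  show ?case
  proof (cases "z \<in> set ws")
    case True
    then obtain us vs where uv: "ws = us @ z # vs" by (meson split_list)
    have "path_edges (us @ [z]) \<subseteq> E" using ws uv path_edges_append[of us z vs] by auto
    moreover have "hd (us @ [z]) = x" using ws uv by (cases us) auto
    ultimately show ?thesis using ws uv by (intro exI[of _ "us @ [z]"]) auto
  next
    case False
    have "path_edges (ws @ [z]) \<subseteq> E"
      using ws step by (auto simp: avoiding_def path_edges_snoc)
    moreover have "(x, z) \<in> (avoiding E X)\<^sup>*" using step by auto
    ultimately show ?thesis using ws False by (intro exI[of _ "ws @ [z]"]) auto
  qed
qed

text \<open>The component \<open>S\<close> of \<open>x\<close> in the graph without \<open>X\<close>
  has two distinct attachment vertices, because the at least two vertices of \<open>X\<close> remain
  outside \<open>S\<close>. They lie in \<open>X\<close>, as \<open>S\<close> is closed under steps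
  avoiding \<open>X\<close>, and a path inside \<open>S\<close> joins their neighbours.\<close>

lemma nonseparable_chord:
  assumes G: "finite_simple_graph G" "nonseparable G"
    and X: "X \<subseteq> vertices G" "2 \<le> card X" and x: "x \<in> vertices G" "x \<notin> X"
  obtains a ws b where "a \<in> X" "b \<in> X" "a \<noteq> b" "ws \<noteq> []" "distinct ws" "set ws \<inter> X = {}"
    "set ws \<subseteq> (avoiding (edges G) X)\<^sup>* `` {x}" "path_edges (a # ws @ [b]) \<subseteq> edges G"
proof -
  let ?R = "avoiding (edges G) X"
  define S where "S = ?R\<^sup>* `` {x}"
  have S: "S \<subseteq> vertices G - X"
  proof
    fix y assume "y \<in> S"
    then have "(x, y) \<in> ?R\<^sup>*" by (simp add: S_def)
    then show "y \<in> vertices G - X"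
      by (induction rule: rtrancl_induct)
        (use x G in \<open>auto simp: avoiding_def finite_simple_graph_def\<close>)
  qed
  have "finite (vertices G)" using G by (simp add: finite_simple_graph_def)
  then have "card X \<le> card (vertices G - S)" using S X by (intro card_mono) auto
  moreover have "S \<noteq> {}" "S \<subseteq> vertices G" using S by (auto simp: S_def)
  ultimately obtain a b s t where ab: "a \<noteq> b" "a \<in> vertices G - S" "b \<in> vertices G - S"
    "s \<in> S" "{a, s} \<in> edges G" "t \<in> S" "{b, t} \<in> edges G"
    using G(2) X(2) unfolding nonseparable_def by (meson le_trans)
  have inX: "c \<in> X" if "c \<notin> S" "u \<in> S" "{c, u} \<in> edges G" for c u
  proof (rule ccontr)
    assume "c \<notin> X"
    then have "(u, c) \<in> ?R" using that S by (auto simp: avoiding_def insert_commute)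
    then have "c \<in> S" using that(2) unfolding S_def by (auto intro: rtrancl_into_rtrancl)
    then show False using that by blast
  qed
  have "(s, t) \<in> ?R\<^sup>*"
    using ab rtrancl_avoiding_sym[of x s] unfolding S_def by (auto intro: rtrancl_trans)
  then obtain ws where ws: "distinct ws" "ws \<noteq> []" "hd ws = s" "last ws = t"
    "set ws \<subseteq> ?R\<^sup>* `` {s}" "path_edges ws \<subseteq> edges G" using avoiding_path[of s t] by metis
  have wS: "set ws \<subseteq> S" using ws(5) ab(4) unfolding S_def by (auto intro: rtrancl_trans)
  have "path_edges (a # ws @ [b]) = insert {a, s} (path_edges (ws @ [b]))"
    using ws by (cases ws) auto
  also have "path_edges (ws @ [b]) = insert {t, b} (path_edges ws)"
    using ws(2,4) by (simp add: path_edges_snoc)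
  finally have "path_edges (a # ws @ [b]) \<subseteq> edges G" using ws ab by (auto simp: insert_commute)
  moreover have "a \<in> X" "b \<in> X" using inX ab by blast+
  moreover have "set ws \<inter> X = {}" using wS S by blast
  ultimately show ?thesis using that[of a b ws] ab(1) ws(1,2) wS unfolding S_def by metis
qed

lemma nonseparable_cycle:
  assumes G: "finite_simple_graph G" "nonseparable G" and V: "3 \<le> card (vertices G)"
  obtains xs where "distinct xs" "3 \<le> length xs" "cycle_edges xs \<subseteq> edges G"
proof -
  obtain v where v: "v \<in> vertices G" using V by fastforce
  have "finite (vertices G)" using G by (simp add: finite_simple_graph_def)
  then have "2 \<le> card (vertices G - {v})" using v V by simp
  then obtain a b where ab: "a \<noteq> b" "a \<in> vertices G" "b \<in> vertices G" "a \<noteq> v" "b \<noteq> v"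
    "{a, v} \<in> edges G" "{b, v} \<in> edges G"
    using G(2) v unfolding nonseparable_def by (metis Diff_iff empty_iff empty_subsetI insert_iff insert_subset)
  \<comment> \<open>With \<open>X = {v, b}\<close> and start \<open>a\<close>, the chord is a path
    from one of \<open>v\<close>, \<open>b\<close> to the other; the edge \<open>{b, v}\<close>
    closes it to a cycle.\<close>
  obtain c ws d where w: "c \<in> {v, b}" "d \<in> {v, b}" "c \<noteq> d" "ws \<noteq> []" "distinct ws" "set ws \<inter> {v, b} = {}"
    "path_edges (c # ws @ [d]) \<subseteq> edges G"
    by (rule nonseparable_chord[OF G, of "{v, b}" a]) (use ab v in auto)
  have "{d, c} = {b, v}" using w by auto
  then have "cycle_edges (c # ws @ [d]) \<subseteq> edges G"
    using w ab cycle_edges_split[of c ws d "[]"] by auto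
  moreover have "distinct (c # ws @ [d])" "3 \<le> length (c # ws @ [d])"
    using w by (auto simp: Suc_le_eq)
  ultimately show ?thesis using that by blast
qed

section \<open>Plane graphs\<close>

locale plane_graph =
  fixes G :: "'a ugraph" and p :: "'a \<Rightarrow> complex" and \<gamma> :: "'a set \<Rightarrow> real \<Rightarrow> complex"
  assumes simple: "finite_simple_graph G" and drawing: "plane_drawing G p \<gamma>"
begin

definition trace :: "'a set set \<Rightarrow> complex set" where
  "trace F = (\<Union>e \<in> F. path_image (\<gamma> e))"

definition open_arc :: "'a set \<Rightarrow> complex set" where
  "open_arc e = path_image (\<gamma> e) - p ` e"

definition verts_in :: "complex set \<Rightarrow> 'a set" where
  "verts_in D = {v \<in> vertices G. p v \<in> D}"

text \<open>Only the open arc is tested, so a chord counts as an edge inside \<open>D\<close>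
  although its ends lie on the boundary.\<close>

definition edges_in :: "complex set \<Rightarrow> 'a set set" where
  "edges_in D = {e \<in> edges G. open_arc e \<subseteq> D}"

lemma finite_vertices: "finite (vertices G)"
  using simple by (simp add: finite_simple_graph_def)

lemma edge_subset: "e \<in> edges G \<Longrightarrow> e \<subseteq> vertices G"
  using simple by (simp add: finite_simple_graph_def)

lemma finite_edges: "finite (edges G)"
  by (rule finite_subset[of _ "Pow (vertices G)"]) (use edge_subset finite_vertices in auto)

lemma edge_ends:
  assumes "e \<in> edges G" "v \<in> e"
  obtains w where "e = {v, w}" "v \<noteq> w" "arc_between (path_image (\<gamma> e)) (p v) (p w)"
proof -
  have "card e = 2" using simple assms by (simp add: finite_simple_graph_def)
  then obtain w where w: "e = {v, w}" "v \<noteq> w" using assms(2) by (auto simp: card_2_iff)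
  have "arc (\<gamma> e)" "{pathstart (\<gamma> e), pathfinish (\<gamma> e)} = {p v, p w}"
    using drawing assms w by (auto simp: plane_drawing_def)
  then have "arc_between (path_image (\<gamma> e)) (p v) (p w) \<or> arc_between (path_image (\<gamma> e)) (p w) (p v)"
    unfolding arc_between_def by (auto simp: doubleton_eq_iff)
  then show ?thesis using that w arc_between_sym by blast
qed

lemma p_eq: "u \<in> vertices G \<Longrightarrow> v \<in> vertices G \<Longrightarrow> p u = p v \<longleftrightarrow> u = v"
  using drawing by (auto simp: plane_drawing_def inj_on_def)

lemma path_image_vertices: "e \<in> edges G \<Longrightarrow> path_image (\<gamma> e) \<inter> p ` vertices G = p ` e"
  using drawing unfolding plane_drawing_def by blast

lemma open_arc_props:
  assumes "e \<in> edges G"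
  shows "open_arc e \<noteq> {}" "connected (open_arc e)" "path_image (\<gamma> e) = open_arc e \<union> p ` e"
    "open_arc e \<inter> p ` vertices G = {}"
proof -
  have "e \<noteq> {}" using simple assms by (auto simp: finite_simple_graph_def)
  then obtain v where v: "v \<in> e" by blast
  obtain w where w: "e = {v, w}" "arc_between (path_image (\<gamma> e)) (p v) (p w)"
    using edge_ends[OF assms v] by blast
  show "open_arc e \<noteq> {}" "connected (open_arc e)"
    using arc_betweenD(6,7)[OF w(2)] unfolding open_arc_def by (simp_all add: w(1))
  have im: "path_image (\<gamma> e) \<inter> p ` vertices G = p ` e" using path_image_vertices assms .
  then show "path_image (\<gamma> e) = open_arc e \<union> p ` e" unfolding open_arc_def by blast
  show "open_arc e \<inter> p ` vertices G = {}" using im unfolding open_arc_def by blast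
qed

lemma trace_Un: "trace (F \<union> F') = trace F \<union> trace F'"
  unfolding trace_def by blast

lemma p_in_trace:
  assumes "F \<subseteq> edges G" "v \<in> vertices G"
  shows "p v \<in> trace F \<longleftrightarrow> v \<in> \<Union>F"
proof
  assume "p v \<in> trace F"
  then obtain e where e: "e \<in> F" "p v \<in> path_image (\<gamma> e)" unfolding trace_def by blast
  have "path_image (\<gamma> e) \<inter> p ` vertices G = p ` e" using path_image_vertices assms e by blast
  then obtain u where "u \<in> e" "p v = p u" using e assms by blast
  then show "v \<in> \<Union>F" using p_eq[of v u] assms e edge_subset by blast
next
  assume "v \<in> \<Union>F"
  then obtain e where "e \<in> F" "v \<in> e" by blast
  then show "p v \<in> trace F" unfolding trace_def using open_arc_props(3)[of e] assms by blast
qed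

lemma trace_Int:
  assumes "F \<subseteq> edges G" "F' \<subseteq> edges G" "F \<inter> F' = {}"
  shows "trace F \<inter> trace F' = p ` (\<Union>F \<inter> \<Union>F')"
proof
  show "trace F \<inter> trace F' \<subseteq> p ` (\<Union>F \<inter> \<Union>F')"
  proof
    fix z assume "z \<in> trace F \<inter> trace F'"
    then obtain e e' where e: "e \<in> F" "e' \<in> F'" "z \<in> path_image (\<gamma> e) \<inter> path_image (\<gamma> e')"
      unfolding trace_def by blast
    moreover have "e \<noteq> e'" using e assms by blast
    moreover have "e \<in> edges G" "e' \<in> edges G" using e assms by blast+
    ultimately have "z \<in> p ` (e \<inter> e')" using drawing unfolding plane_drawing_def by metis
    then show "z \<in> p ` (\<Union>F \<inter> \<Union>F')" using e by blast
  qed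
next
  have "\<Union>F \<subseteq> vertices G" using assms edge_subset by blast
  then show "p ` (\<Union>F \<inter> \<Union>F') \<subseteq> trace F \<inter> trace F'"
    using p_in_trace[OF assms(1)] p_in_trace[OF assms(2)] by fast
qed

lemma trace_path:
  assumes "distinct xs" "2 \<le> length xs" "path_edges xs \<subseteq> edges G"
  shows "arc_between (trace (path_edges xs)) (p (hd xs)) (p (last xs))"
  using assms
proof (induction xs rule: path_edges.induct)
  case (1 x y zs)
  obtain w where "{x, y} = {x, w}" "arc_between (path_image (\<gamma> {x, y})) (p x) (p w)"
    using edge_ends[of "{x, y}" x] 1 by auto
  then have xy: "arc_between (trace {{x, y}}) (p x) (p y)" by (auto simp: doubleton_eq_iff trace_def)
  show ?case
  proof (cases zs)
    case Nil
    then show ?thesis using xy by simp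
  next
    case (Cons z ys)
    have IH: "arc_between (trace (path_edges (y # zs))) (p y) (p (last (y # zs)))"
      using 1 Cons by simp
    have "x \<notin> \<Union>(path_edges (y # zs))" using 1 Union_path_edges_subset[of "y # zs"] by auto
    then have "trace {{x, y}} \<inter> trace (path_edges (y # zs)) = p ` (\<Union>{{x, y}} \<inter> \<Union>(path_edges (y # zs)))"
      by (intro trace_Int) (use 1 in auto)
    then have "trace {{x, y}} \<inter> trace (path_edges (y # zs)) \<subseteq> {p y}"
      using \<open>x \<notin> _\<close> by auto
    from arc_between_join[OF xy IH this] show ?thesis
      using trace_Un[of "{{x, y}}" "path_edges (y # zs)"] by simp
  qed
qed auto

section \<open>Position of edges relative to a closed curve\<close>

lemma open_arc_disjoint_trace:
  assumes "e \<in> edges G" "F \<subseteq> edges G" "e \<notin> F"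
  shows "open_arc e \<inter> trace F = {}"
proof -
  have "trace {e} \<inter> trace F = p ` (\<Union>{e} \<inter> \<Union>F)" by (rule trace_Int) (use assms in auto)
  then show ?thesis unfolding open_arc_def trace_def by auto
qed

lemma open_arc_in_side:
  assumes "e \<in> edges G" "F \<subseteq> edges G" "e \<notin> F" "sides (trace F) D D'"
  shows "open_arc e \<subseteq> D \<or> open_arc e \<subseteq> D'"
  using sides_connected_cases[OF assms(4)] open_arc_props(2) open_arc_disjoint_trace assms by blast

lemma edges_in_disjoint_curve:
  assumes "F \<subseteq> edges G" "sides (trace F) D D'"
  shows "edges_in D \<inter> F = {}"
proof -
  have "D \<inter> trace F = {}" using assms(2) unfolding sides_def by blast
  moreover have "open_arc e \<subseteq> trace F \<and> open_arc e \<noteq> {}" if "e \<in> F" for e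
    using that open_arc_props[of e] assms(1) unfolding trace_def by blast
  ultimately show ?thesis unfolding edges_in_def by blast
qed

lemma edges_in_disjoint: "D \<inter> D' = {} \<Longrightarrow> edges_in D \<inter> edges_in D' = {}"
  unfolding edges_in_def using open_arc_props(1) by blast

text \<open>The arc of \<open>e\<close> without its other end is connected and misses the curve,
  wherever that other end lies. So one end off the curve determines the side of the whole
  edge.\<close>

lemma edge_in_side_iff:
  assumes e: "e \<in> edges G" "v \<in> e" and F: "F \<subseteq> edges G" "v \<notin> \<Union>F" and s: "sides (trace F) D D'"
  shows "e \<in> edges_in D \<longleftrightarrow> p v \<in> D"
proof -
  obtain w where w: "e = {v, w}" "v \<noteq> w" "arc_between (path_image (\<gamma> e)) (p v) (p w)"
    using edge_ends[OF e] by blast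
  have vw: "p v \<noteq> p w" using p_eq[of v w] e edge_subset w by blast
  let ?X = "path_image (\<gamma> e) - {p w}"
  have X: "?X = insert (p v) (open_arc e)"
    using open_arc_props(3)[OF e(1)] w vw unfolding open_arc_def by auto
  have "e \<notin> F" using F e by blast
  then have "open_arc e \<inter> trace F = {}" using open_arc_disjoint_trace e F by blast
  moreover have "p v \<notin> trace F" using p_in_trace F e edge_subset by blast
  ultimately have "?X \<subseteq> D \<or> ?X \<subseteq> D'"
    using arc_between_half_open[OF w(3)] unfolding X by (intro sides_connected_cases[OF s]) auto
  moreover have "D \<inter> D' = {}" using s unfolding sides_def by blast
  ultimately show ?thesis
    using X open_arc_props(1)[OF e(1)] e unfolding edges_in_def by auto
qed

text \<open>An edge in \<open>D\<close> with both ends on the cycle is itself the chord. Otherwise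
  it has an end off the cycle; \<open>nonseparable_chord\<close> joins two cycle vertices through
  the component of that end, which cannot leave \<open>D\<close> without meeting the cycle.\<close>

lemma chord_in_side:
  assumes ns: "nonseparable G" and xs: "distinct xs" "2 \<le> length xs" "cycle_edges xs \<subseteq> edges G"
    and s: "sides (trace (cycle_edges xs)) D D'" and ne: "edges_in D \<noteq> {}"
  obtains a ws b where "a \<in> set xs" "b \<in> set xs" "distinct (a # ws @ [b])"
    "set ws \<inter> set xs = {}" "set ws \<subseteq> verts_in D" "path_edges (a # ws @ [b]) \<subseteq> edges_in D"
proof -
  let ?K = "cycle_edges xs"
  have K: "\<Union>?K = set xs" using Union_cycle_edges xs by blast
  have sV: "set xs \<subseteq> vertices G" using K xs edge_subset by blast
  obtain e where e: "e \<in> edges_in D" using ne by blast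
  have eE: "e \<in> edges G" using e by (simp add: edges_in_def)
  then have "card e = 2" using simple by (simp add: finite_simple_graph_def)
  then obtain x y where xy: "e = {x, y}" "x \<noteq> y" by (auto simp: card_2_iff)
  show ?thesis
  proof (cases "e \<subseteq> set xs")
    case True
    then show ?thesis using that[of x y "[]"] xy e by auto
  next
    case False
    then obtain v where v: "v \<in> e" "v \<notin> set xs" by blast
    have vV: "v \<in> vertices G" using v eE edge_subset by blast
    have vD: "p v \<in> D" using edge_in_side_iff[OF eE v(1) xs(3) _ s] e v K by blast
    have reach: "u \<notin> set xs \<and> p u \<in> D \<and> u \<in> vertices G" if "(v, u) \<in> (avoiding (edges G) (set xs))\<^sup>*" for u
      using that
    proof (induction rule: rtrancl_induct)
      case base
      then show ?case using v vD vV by blast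
    next
      case (step y z)
      then have yz: "{y, z} \<in> edges G" "y \<notin> set xs" "z \<notin> set xs" by (auto simp: avoiding_def)
      have "{y, z} \<in> edges_in D" using edge_in_side_iff[OF yz(1) _ xs(3) _ s, of y] step yz K by blast
      then have "p z \<in> D" using edge_in_side_iff[OF yz(1) _ xs(3) _ s, of z] yz K by blast
      then show ?case using yz edge_subset[OF yz(1)] by blast
    qed
    have "2 \<le> card (set xs)" using xs by (simp add: distinct_card)
    then obtain a ws b where w: "a \<in> set xs" "b \<in> set xs" "a \<noteq> b" "ws \<noteq> []" "distinct ws"
      "set ws \<inter> set xs = {}" "set ws \<subseteq> (avoiding (edges G) (set xs))\<^sup>* `` {v}"
      "path_edges (a # ws @ [b]) \<subseteq> edges G"
      using nonseparable_chord[OF simple ns sV _ vV v(2)] by metis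
    have wD: "set ws \<subseteq> verts_in D" using w(7) reach unfolding verts_in_def by blast
    \<comment> \<open>Each edge of the chord has an end in \<open>ws\<close>, off the cycle, and
      that end fixes its side.\<close>
    have "f \<in> edges_in D" if f: "f \<in> path_edges (a # ws @ [b])" for f
    proof -
      have fE: "f \<in> edges G" using f w by blast
      have "path_edges (a # ws @ [b]) = insert {a, hd ws} (path_edges (ws @ [b]))" using w(4) by (cases ws) auto
      moreover have "path_edges (ws @ [b]) = insert {last ws, b} (path_edges ws)"
        using w(4) by (rule path_edges_snoc)
      moreover have "g \<inter> set ws \<noteq> {}" if "g \<in> path_edges ws" for g
      proof -
        have "g \<in> edges G" using that w(8) calculation by auto
        then have "g \<noteq> {}" using simple by (auto simp: finite_simple_graph_def)
        then show ?thesis using that Union_path_edges_subset[of ws] by blast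
      qed
      ultimately have "f \<inter> set ws \<noteq> {}" using f w(4) by auto
      then obtain u where u: "u \<in> f" "u \<in> set ws" by blast
      then have "u \<notin> set xs" "p u \<in> D" using w wD unfolding verts_in_def by blast+
      then show ?thesis using edge_in_side_iff[OF fE u(1) xs(3) _ s] K by blast
    qed
    moreover have "distinct (a # ws @ [b])" using w by auto
    ultimately show ?thesis using that[of a b ws] w(1,2,6) wD by blast
  qed
qed

text \<open>The bookkeeping for cutting \<open>D\<close> along a chord \<open>Q\<close>:
  \<open>Q\<close> has one more edge than inner vertices, and no triangle is counted in both parts
  because \<open>Q\<close>, a path, contains none. The two disjunctions give the new cycles length
  at least 3.\<close>

lemma side_count_step:
  fixes a b :: 'a and us vs ws :: "'a list"
  defines "A \<equiv> path_edges (a # us @ [b])" and "B \<equiv> path_edges (b # vs @ [a])"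
    and "Q \<equiv> path_edges (a # ws @ [b])"
  assumes C: "distinct (a # us @ b # vs)" "3 \<le> length (a # us @ b # vs)"
    "cycle_edges (a # us @ b # vs) \<subseteq> edges G" "sides (trace (cycle_edges (a # us @ b # vs))) D D'"
    and P: "distinct (a # ws @ [b])" "set ws \<inter> set (a # us @ b # vs) = {}"
      "set ws \<subseteq> verts_in D" "Q \<subseteq> edges_in D"
  obtains D1 E1 D2 E2 where
    "cycle_edges (a # us @ b # rev ws) = A \<union> Q" "cycle_edges (b # vs @ a # ws) = B \<union> Q"
    "sides (trace (A \<union> Q)) D1 E1" "sides (trace (B \<union> Q)) D2 E2"
    "us \<noteq> [] \<or> ws \<noteq> []" "vs \<noteq> [] \<or> ws \<noteq> []"
    "card (edges_in D) = card (edges_in D1) + card (edges_in D2) + length ws + 1"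
    "card (verts_in D) = card (verts_in D1) + card (verts_in D2) + length ws"
    "card (triangles (edges_in D1 \<union> (A \<union> Q))) + card (triangles (edges_in D2 \<union> (B \<union> Q)))
       \<le> card (triangles (edges_in D \<union> cycle_edges (a # us @ b # vs)))"
proof -
  let ?xs = "a # us @ b # vs"
  have cAB: "cycle_edges ?xs = A \<union> B" unfolding A_def B_def by (rule cycle_edges_split)
  have c1: "cycle_edges (a # us @ b # rev ws) = A \<union> Q"
    using path_edges_rev[of "a # ws @ [b]"] by (simp add: cycle_edges_split A_def Q_def)
  have c2: "cycle_edges (b # vs @ a # ws) = B \<union> Q" by (simp add: cycle_edges_split B_def Q_def)
  have E: "A \<subseteq> edges G" "B \<subseteq> edges G" "Q \<subseteq> edges G" using C cAB P unfolding edges_in_def by auto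
  have UA: "\<Union>A = set (a # us @ [b])" and UB: "\<Union>B = set (b # vs @ [a])" and UQ: "\<Union>Q = set (a # ws @ [b])"
    unfolding A_def B_def Q_def by (rule Union_path_edges; simp)+
  have fin: "finite A" "finite B" "finite Q" unfolding A_def B_def Q_def by simp_all
  have cQ: "card Q = length ws + 1" unfolding Q_def using P by (subst card_path_edges; auto)
  have AB: "A \<inter> B = {}" unfolding A_def B_def by (rule cycle_split_disjoint[OF C(1,2)])
  have Kin: "edges_in D \<inter> (A \<union> B) = {}" using edges_in_disjoint_curve[OF C(3,4)] cAB by simp
  then have QAB: "A \<inter> Q = {}" "B \<inter> Q = {}" using P by blast+
  have arcs: "arc_between (trace A) (p a) (p b)" "arc_between (trace B) (p a) (p b)" "arc_between (trace Q) (p a) (p b)"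
    using trace_path[of "a # us @ [b]"] trace_path[of "b # vs @ [a]"] trace_path[of "a # ws @ [b]"] C P E
    unfolding A_def B_def Q_def by (auto intro: arc_between_sym)
  have tAB: "trace A \<inter> trace B \<subseteq> {p a, p b}"
    using trace_Int[OF E(1,2) AB] UA UB C by auto
  have K: "sides (trace A \<union> trace B) D D'" using C(4) cAB by (simp add: trace_Un)
  have QD: "trace Q - {p a, p b} \<subseteq> D"
  proof
    fix z assume z: "z \<in> trace Q - {p a, p b}"
    then obtain e where e: "e \<in> Q" "z \<in> path_image (\<gamma> e)" unfolding trace_def by blast
    then have "z \<in> open_arc e \<or> z \<in> p ` e" using open_arc_props(3)[of e] E by blast
    then show "z \<in> D"
    proof
      assume "z \<in> open_arc e"
      then show ?thesis using e P unfolding edges_in_def by blast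
    next
      assume "z \<in> p ` e"
      then have "z \<in> p ` set ws" using e UQ z by auto
      then show ?thesis using P unfolding verts_in_def by blast
    qed
  qed
  obtain D1 E1 D2 E2 where s1: "sides (trace A \<union> trace Q) D1 E1" and s2: "sides (trace B \<union> trace Q) D2 E2"
    and D12: "D1 \<inter> D2 = {}" and D: "D = D1 \<union> D2 \<union> (trace Q - {p a, p b})"
    by (rule sides_split[OF arcs tAB K QD])
  note s1' = s1[folded trace_Un] and s2' = s2[folded trace_Un]
  have V: "a \<in> vertices G" "b \<in> vertices G" "set ws \<subseteq> vertices G"
  proof -
    have "\<Union>Q \<subseteq> vertices G" using E(3) edge_subset by blast
    then show "a \<in> vertices G" "b \<in> vertices G" "set ws \<subseteq> vertices G" using UQ by auto
  qed
  have D1Q: "D1 \<inter> trace Q = {}" "D2 \<inter> trace Q = {}" using sides_disjoint(2) s1 s2 by blast+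
  have pQ: "p v \<in> trace Q - {p a, p b} \<longleftrightarrow> v \<in> set ws" if "v \<in> vertices G" for v
    using p_in_trace[OF E(3) that] UQ p_eq[OF that] V P by auto
  have vD: "verts_in D = verts_in D1 \<union> verts_in D2 \<union> set ws"
    using pQ V unfolding verts_in_def D by blast
  have fv: "finite (verts_in X)" for X using finite_vertices unfolding verts_in_def by simp
  have "verts_in D1 \<inter> verts_in D2 = {}" using D12 unfolding verts_in_def by blast
  moreover have "(verts_in D1 \<union> verts_in D2) \<inter> set ws = {}" using D1Q pQ unfolding verts_in_def by blast
  ultimately have cv: "card (verts_in D) = card (verts_in D1) + card (verts_in D2) + length ws"
    using P(1) unfolding vD by (simp add: card_Un_disjoint fv distinct_card)
  have sub: "edges_in D1 \<subseteq> edges_in D" "edges_in D2 \<subseteq> edges_in D" unfolding edges_in_def D by blast+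
  \<comment> \<open>The open arc is confined to one side of each new curve and misses the chord, so
    within \<open>D\<close> it falls into \<open>D1\<close> or \<open>D2\<close> as a whole.\<close>
  have "e \<in> edges_in D1 \<union> edges_in D2" if e: "e \<in> edges_in D" "e \<notin> Q" for e
  proof -
    have eE: "e \<in> edges G" "open_arc e \<subseteq> D" using e by (auto simp: edges_in_def)
    have n: "e \<notin> A \<union> Q" "e \<notin> B \<union> Q" using e Kin by blast+
    have h: "open_arc e \<subseteq> D1 \<or> open_arc e \<subseteq> E1" "open_arc e \<subseteq> D2 \<or> open_arc e \<subseteq> E2"
      using open_arc_in_side[OF eE(1) _ n(1) s1'] open_arc_in_side[OF eE(1) _ n(2) s2'] E by blast+
    have "open_arc e \<inter> trace Q = {}" using open_arc_disjoint_trace[OF eE(1) E(3) e(2)] .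
    then have "open_arc e \<subseteq> D1 \<union> D2" using eE(2) D by blast
    moreover have "D1 \<inter> E1 = {}" "D2 \<inter> E2 = {}" using s1 s2 sides_disjoint(1) by metis+
    ultimately have "open_arc e \<subseteq> D1 \<or> open_arc e \<subseteq> D2" using h open_arc_props(1)[OF eE(1)] by blast
    then show ?thesis using eE unfolding edges_in_def by blast
  qed
  then have eD: "edges_in D = edges_in D1 \<union> edges_in D2 \<union> Q" using sub P(4) by blast
  have fe: "finite (edges_in X)" for X using finite_edges unfolding edges_in_def by simp
  have dis: "edges_in D1 \<inter> (A \<union> Q) = {}" "edges_in D2 \<inter> (B \<union> Q) = {}"
    using edges_in_disjoint_curve[OF _ s1'] edges_in_disjoint_curve[OF _ s2'] E by blast+
  have e12: "edges_in D1 \<inter> edges_in D2 = {}" using edges_in_disjoint[OF D12] .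
  then have ce: "card (edges_in D) = card (edges_in D1) + card (edges_in D2) + length ws + 1"
    using dis unfolding eD by (subst card_Un_disjoint; simp add: fe fin card_Un_disjoint cQ; blast)
  let ?T1 = "triangles (edges_in D1 \<union> (A \<union> Q))" and ?T2 = "triangles (edges_in D2 \<union> (B \<union> Q))"
    and ?T = "triangles (edges_in D \<union> cycle_edges ?xs)"
  \<comment> \<open>Edges common to both closed parts belong to the chord, so a triangle counted
    twice would be a triangle of a path.\<close>
  have "(edges_in D1 \<union> (A \<union> Q)) \<inter> (edges_in D2 \<union> (B \<union> Q)) \<subseteq> Q"
    using e12 AB Kin sub by blast
  then have "?T1 \<inter> ?T2 \<subseteq> triangles Q" unfolding triangles_Int by (rule triangles_mono)
  then have T12: "?T1 \<inter> ?T2 = {}" using triangles_path_edges[OF P(1)] unfolding Q_def by blast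
  have "edges_in D1 \<union> (A \<union> Q) \<subseteq> edges_in D \<union> cycle_edges ?xs"
    "edges_in D2 \<union> (B \<union> Q) \<subseteq> edges_in D \<union> cycle_edges ?xs"
    using sub P(4) unfolding cAB by blast+
  then have subT: "?T1 \<union> ?T2 \<subseteq> ?T" by (simp add: triangles_mono)
  have "\<Union>(edges_in D \<union> cycle_edges ?xs) \<subseteq> vertices G"
    using C(3) edge_subset unfolding edges_in_def by blast
  then have fT: "finite ?T" by (intro finite_triangles finite_subset[OF _ finite_vertices])
  then have "finite ?T1" "finite ?T2" using subT finite_subset by (metis le_sup_iff)+
  then have "card ?T1 + card ?T2 \<le> card ?T"
    using card_mono[OF fT subT] T12 by (simp add: card_Un_disjoint)
  \<comment> \<open>If both lists were empty, the chord and the arc of the cycle would be the same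
    edge \<open>{a, b}\<close>.\<close>
  moreover have "us \<noteq> [] \<or> ws \<noteq> []" "vs \<noteq> [] \<or> ws \<noteq> []"
    using QAB unfolding A_def B_def Q_def by auto
  ultimately show ?thesis using that[OF c1 c2 s1' s2'] ce cv by blast
qed

text \<open>The constants fit the faces: a side without edges has boundary length 3, where the
  triangle pays 3, or at least 6, because 4 and 5 are excluded. Cutting along a chord is exact in
  the arithmetic, so induction on the number of edges in the side applies.\<close>

lemma side_count:
  assumes ns: "nonseparable G" and no4: "\<not> has_cycle_of_length G 4" and no5: "\<not> has_cycle_of_length G 5"
    and "distinct xs" "3 \<le> length xs" "cycle_edges xs \<subseteq> edges G" "sides (trace (cycle_edges xs)) D D'"
  shows "4 * card (edges_in D) + 6
    \<le> 6 * card (verts_in D) + 3 * card (triangles (edges_in D \<union> cycle_edges xs)) + length xs"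
  using assms(4-7)
proof (induction "card (edges_in D)" arbitrary: xs D D' rule: less_induct)
  case less
  note C = less.prems
  have fe: "finite (edges_in X)" for X using finite_edges unfolding edges_in_def by simp
  show ?case
  proof (cases "edges_in D = {}")
    case True
    have cyc: "is_cycle G xs" using is_cycleI[OF simple C(1-3)] .
    then have "length xs \<noteq> 4" "length xs \<noteq> 5" using no4 no5 unfolding has_cycle_of_length_def by blast+
    then consider "length xs = 3" | "6 \<le> length xs" using C(2) by linarith
    then show ?thesis
    proof cases
      case 1
      then obtain x y z where xs: "xs = [x, y, z]" by (auto simp: length_Suc_conv numeral_3_eq_3)
      have "{e. e \<subseteq> {x, y, z} \<and> card e = 2} \<subseteq> {{x, y}, {y, z}, {z, x}}"
        by (auto simp: card_2_iff)
      moreover have "{{x, y}, {y, z}, {z, x}} \<subseteq> cycle_edges xs" using xs by (simp add: cycle_edges_def)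
      moreover have "card {x, y, z} = 3" using xs C(1) by simp
      ultimately have "{x, y, z} \<in> triangles (cycle_edges xs)" unfolding triangles_def by blast
      moreover have "finite (triangles (cycle_edges xs))"
        by (rule finite_triangles) (use Union_cycle_edges[of xs] C(2) in simp)
      ultimately have "0 < card (triangles (cycle_edges xs))" by (auto simp: card_gt_0_iff)
      then show ?thesis using True 1 by simp
    qed (use True in simp)
  next
    case False
    obtain a ws b where P: "a \<in> set xs" "b \<in> set xs" "distinct (a # ws @ [b])"
      "set ws \<inter> set xs = {}" "set ws \<subseteq> verts_in D" "path_edges (a # ws @ [b]) \<subseteq> edges_in D"
      using chord_in_side[OF ns C(1) _ C(3,4) False] C(2) by (metis Suc_leD eval_nat_numeral(3))
    obtain us vs where uv: "distinct (a # us @ b # vs)" "set (a # us @ b # vs) = set xs"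
      "length (a # us @ b # vs) = length xs" "cycle_edges (a # us @ b # vs) = cycle_edges xs"
      using cycle_at2[OF C(1) P(1,2)] P(3) by auto
    let ?A = "path_edges (a # us @ [b])" and ?B = "path_edges (b # vs @ [a])" and ?Q = "path_edges (a # ws @ [b])"
    have P2: "set ws \<inter> set (a # us @ b # vs) = {}" using P(4) uv(2) by simp
    obtain D1 E1 D2 E2 where
      S: "cycle_edges (a # us @ b # rev ws) = ?A \<union> ?Q" "cycle_edges (b # vs @ a # ws) = ?B \<union> ?Q"
      "sides (trace (?A \<union> ?Q)) D1 E1" "sides (trace (?B \<union> ?Q)) D2 E2"
      "us \<noteq> [] \<or> ws \<noteq> []" "vs \<noteq> [] \<or> ws \<noteq> []"
      "card (edges_in D) = card (edges_in D1) + card (edges_in D2) + length ws + 1"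
      "card (verts_in D) = card (verts_in D1) + card (verts_in D2) + length ws"
      "card (triangles (edges_in D1 \<union> (?A \<union> ?Q))) + card (triangles (edges_in D2 \<union> (?B \<union> ?Q)))
         \<le> card (triangles (edges_in D \<union> cycle_edges (a # us @ b # vs)))"
      by (rule side_count_step[OF uv(1) _ _ _ P(3) P2 P(5,6), of D']) (use C uv in auto)
    have E: "?A \<subseteq> edges G" "?B \<subseteq> edges G" "?Q \<subseteq> edges G"
      using uv(4) C(3) P(6) cycle_edges_split[of a us b vs] unfolding edges_in_def by auto
    have l1: "3 \<le> length (a # us @ b # rev ws)" using S(5) by (cases us; cases ws) auto
    have l2: "3 \<le> length (b # vs @ a # ws)" using S(6) by (cases vs; cases ws) auto
    \<comment> \<open>The chord has at least one edge, hence each part has fewer edges than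
      \<open>D\<close>.\<close>
    have 1: "4 * card (edges_in D1) + 6
      \<le> 6 * card (verts_in D1) + 3 * card (triangles (edges_in D1 \<union> cycle_edges (a # us @ b # rev ws))) + length (a # us @ b # rev ws)"
      by (rule less.hyps[OF _ _ l1]) (use S E uv(1) P(3) P2 in auto)
    have 2: "4 * card (edges_in D2) + 6
      \<le> 6 * card (verts_in D2) + 3 * card (triangles (edges_in D2 \<union> cycle_edges (b # vs @ a # ws))) + length (b # vs @ a # ws)"
      by (rule less.hyps[OF _ _ l2]) (use S E uv(1) P(3) P2 in auto)
    \<comment> \<open>With \<open>q = length ws\<close>, the new cycles have total length
      \<open>length xs + 2 q + 2\<close>. Adding \<open>4 q - 2\<close> to the sum of both bounds
      turns the left side into \<open>4 m + 6\<close> and the \<open>q\<close> terms on the right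
      into \<open>6 q\<close>, the share of the inner vertices of the chord.\<close>
    show ?thesis using 1 2 S(7-9) uv(3,4) unfolding S(1,2) by simp
  qed
qed

lemma cycle_sides_exist:
  assumes xs: "distinct xs" "3 \<le> length xs" "cycle_edges xs \<subseteq> edges G"
  shows "\<exists>D D'. sides (trace (cycle_edges xs)) D D'"
proof -
  \<comment> \<open>One edge and the remaining path serve as the two arcs, so the first has no inner
    vertices.\<close>
  obtain a b vs where ab: "xs = a # [] @ b # vs" using assms(2)
    by (metis Suc_le_length_iff append_Nil numeral_3_eq_3)
  let ?A = "path_edges (a # [] @ [b])" and ?B = "path_edges (b # vs @ [a])"
  have AB: "cycle_edges xs = ?A \<union> ?B" unfolding ab by (rule cycle_edges_split)
  have E: "?A \<subseteq> edges G" "?B \<subseteq> edges G" using xs(3) AB by blast+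
  have "?A \<inter> ?B = {}" using cycle_split_disjoint[of a "[]" b vs] xs ab by simp
  then have "trace ?A \<inter> trace ?B = p ` (\<Union>?A \<inter> \<Union>?B)" by (rule trace_Int[OF E])
  then have "trace ?A \<inter> trace ?B \<subseteq> {p a, p b}" by auto
  moreover have "arc_between (trace ?A) (p a) (p b)"
    using trace_path[of "a # [] @ [b]"] E xs ab by simp
  moreover have "arc_between (trace ?B) (p a) (p b)"
    using trace_path[of "b # vs @ [a]"] E xs ab by (auto intro: arc_between_sym)
  ultimately show ?thesis using sides_exist unfolding AB trace_Un by blast
qed

text \<open>The closures of the two sides of a cycle of length \<open>l\<close> share its edges, its
  vertices and at most one triangle, the cycle itself. When both bounds are added, the terms in
  \<open>l\<close> cancel as \<open>- 4 l = - 6 l + 2 l\<close>, and the doubly counted triangle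
  turns 12 into 9.\<close>

lemma nonseparable_count:
  assumes ns: "nonseparable G" and no4: "\<not> has_cycle_of_length G 4" and no5: "\<not> has_cycle_of_length G 5"
    and V: "3 \<le> card (vertices G)"
  shows "4 * card (edges G) + 9 \<le> 6 * card (vertices G) + 3 * card (triangles (edges G))"
proof -
  obtain xs where xs: "distinct xs" "3 \<le> length xs" "cycle_edges xs \<subseteq> edges G"
    using nonseparable_cycle[OF simple ns V] by blast
  let ?K = "cycle_edges xs"
  obtain D D' where s: "sides (trace ?K) D D'" using cycle_sides_exist[OF xs] by blast
  note s' = sides_sym[OF s]
  have fe: "finite (edges_in X)" "finite ?K" for X
    using finite_edges finite_subset[OF xs(3)] unfolding edges_in_def by simp_all
  have fv: "finite (verts_in X)" for X using finite_vertices unfolding verts_in_def by simp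
  have dis: "D \<inter> D' = {}" "D \<inter> trace ?K = {}" "D' \<inter> trace ?K = {}" "D \<union> D' = - trace ?K"
    using sides_disjoint s s' by (blast, blast, blast) (use s in \<open>auto simp: sides_def\<close>)
  have "e \<in> edges_in D \<union> edges_in D' \<union> ?K" if e: "e \<in> edges G" for e
    using open_arc_in_side[OF e xs(3) _ s] e unfolding edges_in_def by blast
  then have E: "edges G = edges_in D \<union> edges_in D' \<union> ?K" using xs(3) unfolding edges_in_def by blast
  have d: "edges_in D \<inter> ?K = {}" "edges_in D' \<inter> ?K = {}"
    using edges_in_disjoint_curve xs(3) s s' by blast+
  have d': "edges_in D \<inter> edges_in D' = {}" using edges_in_disjoint[OF dis(1)] .
  then have cE: "card (edges G) = card (edges_in D) + card (edges_in D') + length xs"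
    using d card_cycle_edges[OF xs(1,2)] unfolding E by (simp add: card_Un_disjoint fe Int_Un_distrib2)
  have K: "\<Union>?K = set xs" by (rule Union_cycle_edges) (use xs(2) in simp)
  have sV: "set xs \<subseteq> vertices G" using K xs(3) edge_subset by blast
  have pK: "p v \<in> trace ?K \<longleftrightarrow> v \<in> set xs" if "v \<in> vertices G" for v
    using p_in_trace[OF xs(3) that] K by simp
  have V: "vertices G = verts_in D \<union> verts_in D' \<union> set xs"
  proof
    show "vertices G \<subseteq> verts_in D \<union> verts_in D' \<union> set xs"
      using pK dis(4) unfolding verts_in_def by blast
  qed (use sV in \<open>auto simp: verts_in_def\<close>)
  have "verts_in D \<inter> set xs = {}" "verts_in D' \<inter> set xs = {}" "verts_in D \<inter> verts_in D' = {}"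
    using pK dis(1-3) unfolding verts_in_def by blast+
  then have cV: "card (vertices G) = card (verts_in D) + card (verts_in D') + length xs"
    unfolding V using xs(1) by (simp add: card_Un_disjoint fv Int_Un_distrib2 distinct_card)
  let ?T = "triangles (edges_in D \<union> ?K)" and ?T' = "triangles (edges_in D' \<union> ?K)"
  have "\<Union>(edges G) \<subseteq> vertices G" using edge_subset by blast
  then have fT: "finite (triangles (edges G))" by (intro finite_triangles finite_subset[OF _ finite_vertices])
  have subT: "?T \<union> ?T' \<subseteq> triangles (edges G)"
    using triangles_mono[of "edges_in D \<union> ?K" "edges G"] triangles_mono[of "edges_in D' \<union> ?K" "edges G"] E
    by blast
  then have f2: "finite ?T" "finite ?T'" using finite_subset[OF _ fT] by blast+
  have "(edges_in D \<union> ?K) \<inter> (edges_in D' \<union> ?K) = ?K" using d' by blast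
  then have TT: "?T \<inter> ?T' = triangles ?K" by (simp add: triangles_Int)
  have "S = set xs" if S: "S \<in> triangles ?K" for S
    using triangle_in_cycle[OF xs(1) S] triangles_subset_Union[OF S] K by blast
  then have "triangles ?K \<subseteq> {set xs}" by blast
  then have "card (triangles ?K) \<le> 1" by (metis card_mono card.empty card_insert_disjoint empty_iff finite.emptyI finite_insert One_nat_def)
  then have "card ?T + card ?T' \<le> card (triangles (edges G)) + 1"
    using card_Un_Int[OF f2] card_mono[OF fT subT] TT by simp
  then show ?thesis
    using side_count[OF ns no4 no5 xs s] side_count[OF ns no4 no5 xs s'] cE cV by simp
qed

end

section \<open>The edge bound for planar graphs\<close>

lemma planar_subgraph:
  assumes "planar G" "vertices H \<subseteq> vertices G" "edges H \<subseteq> edges G" "finite_simple_graph H"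
  shows "planar H"
proof -
  obtain p \<gamma> where d: "plane_drawing G p \<gamma>" using assms(1) unfolding planar_def by blast
  have inj: "inj_on p (vertices G)"
    and im: "\<forall>e \<in> edges G. path_image (\<gamma> e) \<inter> p ` vertices G = p ` e"
    using d by (simp_all add: plane_drawing_def)
  have "path_image (\<gamma> e) \<inter> p ` vertices H = p ` e" if e: "e \<in> edges H" for e
  proof -
    have "path_image (\<gamma> e) \<inter> p ` vertices G = p ` e" using im e assms(3) by blast
    moreover have "e \<subseteq> vertices H" using assms(4) e by (simp add: finite_simple_graph_def)
    ultimately show ?thesis using assms(2) by blast
  qed
  then have "plane_drawing H p \<gamma>"
    using d assms(3) inj_on_subset[OF inj assms(2)] unfolding plane_drawing_def by (simp add: subset_iff)
  then show ?thesis unfolding planar_def by blast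
qed

lemma has_cycle_subgraph:
  assumes "vertices H \<subseteq> vertices G" "edges H \<subseteq> edges G" "has_cycle_of_length H n"
  shows "has_cycle_of_length G n"
  using assms unfolding has_cycle_of_length_def is_cycle_def by blast

text \<open>A set \<open>S\<close> witnessing separability has at most one neighbour outside; if it
  has none, any outside vertex serves as \<open>a\<close>. Cut vertices and disconnected graphs are
  thus handled together.\<close>

lemma separable_split:
  assumes G: "finite_simple_graph G" and ns: "\<not> nonseparable G"
  obtains S a where "S \<subseteq> vertices G" "S \<noteq> {}" "2 \<le> card (vertices G - S)" "a \<in> vertices G - S"
    "\<And>e. e \<in> edges G \<Longrightarrow> e \<subseteq> insert a S \<or> e \<subseteq> vertices G - S"
proof -
  obtain S where S: "S \<subseteq> vertices G" "S \<noteq> {}" "2 \<le> card (vertices G - S)"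
    and no: "\<not> (\<exists>a b. a \<noteq> b \<and> a \<in> vertices G - S \<and> b \<in> vertices G - S \<and>
          (\<exists>s \<in> S. {a, s} \<in> edges G) \<and> (\<exists>s \<in> S. {b, s} \<in> edges G))"
    using ns unfolding nonseparable_def by metis
  define N where "N = {b \<in> vertices G - S. \<exists>s \<in> S. {b, s} \<in> edges G}"
  have "vertices G - S \<noteq> {}" using S(3) by (metis card.empty not_numeral_le_zero)
  moreover have N: "N \<subseteq> vertices G - S" "\<And>b c. b \<in> N \<Longrightarrow> c \<in> N \<Longrightarrow> b = c" using no unfolding N_def by blast+
  ultimately obtain a where a: "a \<in> vertices G - S" "N \<subseteq> {a}" by (cases "N = {}") blast+
  have "e \<subseteq> insert a S \<or> e \<subseteq> vertices G - S" if e: "e \<in> edges G" for e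
  proof -
    have eV: "e \<subseteq> vertices G" "card e = 2" using G e by (simp_all add: finite_simple_graph_def)
    obtain u v where uv: "e = {u, v}" using eV(2) by (auto simp: card_2_iff)
    have "v \<in> N" if "u \<in> S" "v \<notin> S" using that e eV uv unfolding N_def by (auto simp: insert_commute)
    moreover have "u \<in> N" if "v \<in> S" "u \<notin> S" using that e eV uv unfolding N_def by auto
    ultimately show ?thesis using a uv eV by blast
  qed
  then show ?thesis using that S a(1) by blast
qed

text \<open>The constant 6 is the weight of one vertex: two pieces sharing only the vertex
  \<open>a\<close> count it twice, so their bounds add up to the bound for the whole. A single
  vertex gives equality.\<close>

lemma planar_edge_bound:
  assumes "finite_simple_graph G" "planar G" "\<not> has_cycle_of_length G 4" "\<not> has_cycle_of_length G 5"
    "vertices G \<noteq> {}"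
  shows "4 * card (edges G) + 6 \<le> 6 * card (vertices G) + 3 * card (triangles (edges G))"
  using assms
proof (induction "card (vertices G)" arbitrary: G rule: less_induct)
  case less
  note G = less.prems
  have fin: "finite (vertices G)" and E: "\<And>e. e \<in> edges G \<Longrightarrow> e \<subseteq> vertices G \<and> card e = 2"
    using G(1) by (auto simp: finite_simple_graph_def)
  have fE: "finite (edges G)" by (rule finite_subset[of _ "Pow (vertices G)"]) (use E fin in auto)
  have fT: "finite (triangles F)" if "F \<subseteq> edges G" for F
  proof (intro finite_triangles finite_subset[OF _ fin])
    show "\<Union>F \<subseteq> vertices G" using that E by blast
  qed
  have pos: "0 < card (vertices G)" using fin G(5) by (simp add: card_gt_0_iff)
  consider "card (vertices G) \<le> 2" | "3 \<le> card (vertices G)" "nonseparable G"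
    | "3 \<le> card (vertices G)" "\<not> nonseparable G" by linarith
  then show ?case
  proof cases
    case 1
    show ?thesis
    proof (cases "edges G = {}")
      case False
      have "e = vertices G" if e: "e \<in> edges G" for e
        using card_subset_eq[OF fin, of e] card_mono[OF fin, of e] E[OF e] 1 by linarith
      then have "edges G = {vertices G}" using False by blast
      moreover from this have "card (vertices G) = 2" using E by blast
      ultimately show ?thesis by simp
    qed (use pos in simp)
  next
    case 2
    obtain p \<gamma> where "plane_drawing G p \<gamma>" using G(2) unfolding planar_def by blast
    then interpret plane_graph G p \<gamma> using G(1) by unfold_locales
    show ?thesis using nonseparable_count[OF 2(2) G(3,4) 2(1)] by simp
  next
    case 3
    obtain S a where S: "S \<subseteq> vertices G" "S \<noteq> {}" "2 \<le> card (vertices G - S)" "a \<in> vertices G - S"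
      and cov: "\<And>e. e \<in> edges G \<Longrightarrow> e \<subseteq> insert a S \<or> e \<subseteq> vertices G - S"
      using separable_split[OF G(1) 3(2)] by metis
    define H where "H X = \<lparr>vertices = X, edges = {e \<in> edges G. e \<subseteq> X}\<rparr>" for X
    have bound: "4 * card (edges (H X)) + 6 \<le> 6 * card X + 3 * card (triangles (edges (H X)))"
      if X: "X \<subseteq> vertices G" "X \<noteq> {}" "card X < card (vertices G)" for X
    proof -
      have sub: "vertices (H X) \<subseteq> vertices G" "edges (H X) \<subseteq> edges G" using X by (auto simp: H_def)
      have fs: "finite_simple_graph (H X)"
        using X E finite_subset[OF X(1) fin] by (auto simp: H_def finite_simple_graph_def)
      have "vertices (H X) = X" by (simp add: H_def)
      then show ?thesis
        using less.hyps[of "H X"] X fs planar_subgraph[OF G(2) sub fs] has_cycle_subgraph[OF sub] G(3,4)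
        by metis
    qed
    let ?E1 = "edges (H (insert a S))" and ?E2 = "edges (H (vertices G - S))"
    have fS: "finite S" using finite_subset[OF S(1) fin] .
    have c1: "card (insert a S) = card S + 1" using S(4) fS by simp
    have c2: "card S + card (vertices G - S) = card (vertices G)"
      using card_Diff_subset[OF fS S(1)] card_mono[OF fin S(1)] by simp
    have pS: "0 < card S" using S(2) fS by (simp add: card_gt_0_iff)
    \<comment> \<open>\<open>insert a S\<close> is smaller than the vertex set because at least two
      vertices lie outside \<open>S\<close>, and the complement of \<open>S\<close> is smaller
      because \<open>S\<close> is not empty.\<close>
    have b1: "4 * card ?E1 + 6 \<le> 6 * card (insert a S) + 3 * card (triangles ?E1)"
      by (rule bound) (use S c1 c2 in auto)
    have b2: "4 * card ?E2 + 6 \<le> 6 * card (vertices G - S) + 3 * card (triangles ?E2)"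
      by (rule bound) (use S c2 pS in auto)
    have small: "e \<subseteq> {a}" if "e \<subseteq> insert a S" "e \<subseteq> vertices G - S" for e using that by blast
    have "edges G = ?E1 \<union> ?E2" using cov by (auto simp: H_def)
    moreover have dis: "?E1 \<inter> ?E2 = {}"
    proof -
      have "e \<notin> ?E2" if e: "e \<in> ?E1" for e
      proof
        assume "e \<in> ?E2"
        then have "e \<subseteq> {a}" "card e = 2" using e small E by (auto simp: H_def)
        then show False using card_mono[of "{a}" e] by simp
      qed
      then show ?thesis by blast
    qed
    ultimately have cE: "card (edges G) = card ?E1 + card ?E2"
      using fE card_Un_disjoint[of ?E1 ?E2] by simp
    have sub: "?E1 \<subseteq> edges G" "?E2 \<subseteq> edges G" by (auto simp: H_def)
    have "triangles ?E1 \<inter> triangles ?E2 = {}" using dis by (simp add: triangles_Int triangles_empty)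
    then have "card (triangles ?E1) + card (triangles ?E2) = card (triangles ?E1 \<union> triangles ?E2)"
      using fT[OF sub(1)] fT[OF sub(2)] by (simp add: card_Un_disjoint)
    also have "\<dots> \<le> card (triangles (edges G))"
      by (rule card_mono[OF fT[OF order_refl]]) (use triangles_mono sub in blast)
    finally show ?thesis using b1 b2 cE c1 c2 by simp
  qed
qed

section \<open>Discharging\<close>

lemma handshake:
  assumes "finite W" "finite E" "\<And>e. e \<in> E \<Longrightarrow> e \<subseteq> W \<and> card e = 2"
  shows "(\<Sum>v \<in> W. card {e \<in> E. v \<in> e}) = 2 * card E"
proof -
  have "(\<Sum>v \<in> W. card {e \<in> E. v \<in> e}) = (\<Sum>v \<in> W. \<Sum>e \<in> {e. e \<in> E \<and> v \<in> e}. 1)" by simp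
  also have "\<dots> = (\<Sum>e \<in> E. \<Sum>v \<in> {v. v \<in> W \<and> v \<in> e}. 1)"
    by (rule sum.swap_restrict) (use assms in auto)
  also have "\<dots> = (\<Sum>e \<in> E. 2)"
  proof (rule sum.cong[OF refl])
    fix e assume "e \<in> E"
    then have "{v. v \<in> W \<and> v \<in> e} = e" "card e = 2" using assms(3) by blast+
    then show "(\<Sum>v \<in> {v. v \<in> W \<and> v \<in> e}. 1) = (2::nat)" by simp
  qed
  finally show ?thesis by simp
qed

text \<open>Third vertices \<open>b\<close> and \<open>c\<close> of two different triangles on the
  edge \<open>{v, a}\<close> would form the 4-cycle \<open>b, v, c, a\<close>.\<close>

lemma triangles_sharing_edge:
  assumes G: "finite_simple_graph G" "\<not> has_cycle_of_length G 4"
    and S: "S \<in> triangles (edges G)" "S' \<in> triangles (edges G)" and e: "e \<subseteq> S \<inter> S'" "card e = 2"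
  shows "S = S'"
proof (rule ccontr)
  assume ne: "S \<noteq> S'"
  obtain v a where va: "e = {v, a}" "v \<noteq> a" using e(2) by (auto simp: card_2_iff)
  have third: "\<exists>b. R = {v, a, b} \<and> b \<noteq> v \<and> b \<noteq> a \<and> {v, b} \<in> edges G \<and> {a, b} \<in> edges G"
    if R: "R \<in> triangles (edges G)" "e \<subseteq> R" for R
  proof -
    have "v \<in> R" "a \<in> R" using R(2) va by auto
    obtain y z where yz: "y \<noteq> z" "v \<noteq> y" "v \<noteq> z" "R = {v, y, z}"
      "{v, y} \<in> edges G" "{v, z} \<in> edges G" "{y, z} \<in> edges G"
      by (rule triangle_other_edges[OF R(1) \<open>v \<in> R\<close>])
    then have "a = y \<or> a = z" using \<open>a \<in> R\<close> va(2) by blast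
    then show ?thesis using yz by (auto simp: insert_commute)
  qed
  obtain b where b: "S = {v, a, b}" "b \<noteq> v" "b \<noteq> a" "{v, b} \<in> edges G" "{a, b} \<in> edges G"
    using third[OF S(1)] e(1) by blast
  obtain c where c: "S' = {v, a, c}" "c \<noteq> v" "c \<noteq> a" "{v, c} \<in> edges G" "{a, c} \<in> edges G"
    using third[OF S(2)] e(1) by blast
  have "is_cycle G [b, v, c, a]"
    by (rule is_cycleI[OF G(1)])
      (use b c ne va in \<open>auto simp: cycle_edges_def insert_commute\<close>)
  then show False using G(2) unfolding has_cycle_of_length_def by force
qed

text \<open>Each triangle at \<open>v\<close> uses two edges at \<open>v\<close>, and by
  \<open>triangles_sharing_edge\<close> different triangles use different ones.\<close>

lemma triangles_at_vertex:
  assumes G: "finite_simple_graph G" "\<not> has_cycle_of_length G 4"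
  shows "2 * card {S \<in> triangles (edges G). v \<in> S} \<le> degree G v"
proof -
  let ?T = "{S \<in> triangles (edges G). v \<in> S}" and ?D = "{e \<in> edges G. v \<in> e}"
  define N where "N S = {e. e \<subseteq> S \<and> card e = 2 \<and> v \<in> e}" for S
  have fin: "finite (vertices G)" and E: "\<And>e. e \<in> edges G \<Longrightarrow> e \<subseteq> vertices G"
    using G(1) by (auto simp: finite_simple_graph_def)
  have fE: "finite (edges G)" by (rule finite_subset[of _ "Pow (vertices G)"]) (use E fin in auto)
  have "\<Union>(edges G) \<subseteq> vertices G" using E by blast
  then have fT: "finite ?T" using finite_triangles[of "edges G"] finite_subset[OF _ fin] by simp
  have N: "N S \<subseteq> ?D \<and> card (N S) = 2" if S: "S \<in> ?T" for S
  proof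
    show "N S \<subseteq> ?D" using S unfolding N_def triangles_def by blast
    have "v \<in> S" "S \<in> triangles (edges G)" using S by auto
    obtain y z where yz: "y \<noteq> z" "v \<noteq> y" "v \<noteq> z" "S = {v, y, z}"
      by (rule triangle_other_edges[OF \<open>S \<in> triangles (edges G)\<close> \<open>v \<in> S\<close>])
    then have "N S = {{v, y}, {v, z}}" unfolding N_def by (auto simp: card_2_iff)
    then show "card (N S) = 2" using yz by (simp add: doubleton_eq_iff)
  qed
  have "card (\<Union>S \<in> ?T. N S) = (\<Sum>S \<in> ?T. card (N S))"
  proof (rule card_UN_disjoint[OF fT])
    show "\<forall>S \<in> ?T. finite (N S)" using N fE finite_subset[of _ ?D] by simp
    show "\<forall>S \<in> ?T. \<forall>S' \<in> ?T. S \<noteq> S' \<longrightarrow> N S \<inter> N S' = {}"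
      using triangles_sharing_edge[OF G] unfolding N_def by blast
  qed
  also have "\<dots> = 2 * card ?T" using N by simp
  finally have "2 * card ?T = card (\<Union>S \<in> ?T. N S)" by simp
  also have "\<dots> \<le> card ?D" by (rule card_mono) (use fE N in auto)
  finally show ?thesis unfolding degree_def .
qed

text \<open>A vertex of degree \<open>d\<close> has charge \<open>2 d - 6\<close> and gives \<open>0\<close>, \<open>1\<close> or \<open>2\<close> to each of its triangles
  according to whether \<open>d = 3\<close>, \<open>d = 4\<close> or \<open>d \<ge> 5\<close>; then each triangle receives at least \<open>3\<close>.\<close>

lemma light_edge:
  assumes G: "finite_simple_graph G" "planar G" "\<not> has_cycle_of_length G 4" "\<not> has_cycle_of_length G 5"
    and ne: "edges G \<noteq> {}" and deg: "\<And>v. v \<in> vertices G \<Longrightarrow> degree G v \<le> k" and k: "5 \<le> k"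
  shows "\<exists>u v. {u, v} \<in> edges G \<and> degree G u \<le> 3 \<and> degree G u + degree G v \<le> k + 2"
proof (rule ccontr)
  assume no: "\<not> ?thesis"
  have heavy: "k + 3 \<le> degree G u + degree G v" if "{u, v} \<in> edges G" "degree G u \<le> 3" for u v
  proof -
    have "\<not> degree G u + degree G v \<le> k + 2" using no that by blast
    then show ?thesis by linarith
  qed
  have fin: "finite (vertices G)" and E: "\<And>e. e \<in> edges G \<Longrightarrow> e \<subseteq> vertices G \<and> card e = 2"
    using G(1) by (auto simp: finite_simple_graph_def)
  have fE: "finite (edges G)" by (rule finite_subset[of _ "Pow (vertices G)"]) (use E fin in auto)
  let ?W = "\<Union>(edges G)" and ?T = "triangles (edges G)"
  have WV: "?W \<subseteq> vertices G" using E by blast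
  have fW: "finite ?W" using finite_subset[OF WV fin] .
  have fT: "finite ?T" using finite_triangles[OF fW] .
  \<comment> \<open>Isolated vertices would have charge -6, so the bound is applied to the graph
    without them.\<close>
  define H where "H = \<lparr>vertices = ?W, edges = edges G\<rparr>"
  have sub: "vertices H \<subseteq> vertices G" "edges H \<subseteq> edges G" using WV by (auto simp: H_def)
  have fH: "finite_simple_graph H" using fW E by (auto simp: H_def finite_simple_graph_def)
  have "?W \<noteq> {}"
  proof -
    obtain e where "e \<in> edges G" using ne by blast
    then have "e \<noteq> {}" using E by fastforce
    then show ?thesis using \<open>e \<in> edges G\<close> by blast
  qed
  then have bound: "4 * card (edges G) + 6 \<le> 6 * card ?W + 3 * card ?T"
    using planar_edge_bound[OF fH planar_subgraph[OF G(2) sub fH]] has_cycle_subgraph[OF sub] G(3,4)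
    by (auto simp: H_def)
  \<comment> \<open>An edge at a vertex of degree at most 2 would need a second end of degree at
    least \<open>k + 1\<close>.\<close>
  have low: "3 \<le> degree G v" if vW: "v \<in> ?W" for v
  proof (rule ccontr)
    assume v: "\<not> 3 \<le> degree G v"
    obtain e where e: "e \<in> edges G" "v \<in> e" using vW by blast
    then obtain w where w: "e = {v, w}" using E[OF e(1)] by (auto simp: card_2_iff)
    then have "k + 3 \<le> degree G v + degree G w" "degree G w \<le> k"
      using heavy[of v w] deg[of w] E[OF e(1)] e(1) v by auto
    then show False using v by linarith
  qed
  define g :: "'a \<Rightarrow> nat" where
    "g v = (if degree G v = 3 then 0 else if degree G v = 4 then 1 else 2)" for v
  have g5: "g v = 2" if "5 \<le> degree G v" for v using that by (simp add: g_def)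
  have give: "g v * card {S. S \<in> ?T \<and> v \<in> S} + 6 \<le> 2 * degree G v" if vW: "v \<in> ?W" for v
  proof -
    have t: "2 * card {S. S \<in> ?T \<and> v \<in> S} \<le> degree G v" using triangles_at_vertex[OF G(1,3)] .
    \<comment> \<open>With at most \<open>d div 2\<close> triangles, the gifts total at most 0, 2
      and 4 for \<open>d = 3, 4, 5\<close>, and at most \<open>d \<le> 2 d - 6\<close> from degree 6
      on.\<close>
    consider "degree G v = 3" | "degree G v = 4" | "degree G v = 5" | "6 \<le> degree G v"
      using low[OF vW] by linarith
    then show ?thesis by cases (use t in \<open>simp_all add: g_def\<close>)
  qed
  have get: "3 \<le> (\<Sum>v \<in> S. g v)" if S: "S \<in> ?T" for S
  proof -
    have SW: "S \<subseteq> ?W" using triangles_subset_Union[OF S] .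
    show ?thesis
    proof (cases "\<exists>v \<in> S. degree G v = 3")
      case True
      then obtain v where v: "v \<in> S" "degree G v = 3" by blast
      obtain y z where yz: "y \<noteq> z" "v \<noteq> y" "v \<noteq> z" "S = {v, y, z}" "{v, y} \<in> edges G" "{v, z} \<in> edges G"
        by (rule triangle_other_edges[OF S v(1)])
      \<comment> \<open>Neighbours of a vertex of degree 3 have degree at least
        \<open>k \<ge> 5\<close> and give 2 each.\<close>
      have "5 \<le> degree G y" "5 \<le> degree G z" using heavy[OF yz(5)] heavy[OF yz(6)] v(2) k by linarith+
      then show ?thesis using yz g5 by simp
    next
      case False
      have "1 \<le> g v" if "v \<in> S" for v using that False by (simp add: g_def)
      then have "(\<Sum>v \<in> S. 1) \<le> (\<Sum>v \<in> S. g v)" by (intro sum_mono) simp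
      moreover have "card S = 3" using S by (simp add: triangles_def)
      ultimately show ?thesis by simp
    qed
  qed
  \<comment> \<open>The gifts are counted twice, by triangles and by vertices.\<close>
  have "3 * card ?T \<le> (\<Sum>S \<in> ?T. \<Sum>v \<in> S. g v)" using sum_mono[of ?T "\<lambda>_. 3" "\<lambda>S. \<Sum>v \<in> S. g v"] get by simp
  also have "\<dots> = (\<Sum>S \<in> ?T. \<Sum>v \<in> {v. v \<in> ?W \<and> v \<in> S}. g v)"
    by (intro sum.cong refl) (use triangles_subset_Union in blast)
  also have "\<dots> = (\<Sum>v \<in> ?W. \<Sum>S \<in> {S. S \<in> ?T \<and> v \<in> S}. g v)"
    by (rule sum.swap_restrict[symmetric, OF fW fT])
  also have "\<dots> = (\<Sum>v \<in> ?W. g v * card {S. S \<in> ?T \<and> v \<in> S})" by (simp add: mult.commute)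
  finally have "3 * card ?T + 6 * card ?W \<le> (\<Sum>v \<in> ?W. g v * card {S. S \<in> ?T \<and> v \<in> S} + 6)"
    by (simp add: sum.distrib)
  also have "\<dots> \<le> (\<Sum>v \<in> ?W. 2 * degree G v)" by (rule sum_mono[OF give])
  also have "\<dots> = 4 * card (edges G)"
    using handshake[OF fW fE] E by (auto simp: degree_def sum_distrib_left[symmetric])
  \<comment> \<open>So \<open>3 t + 6 n \<le> 4 m\<close>, while the edge bound says
    \<open>4 m + 6 \<le> 6 n + 3 t\<close>.\<close>
  finally show False using bound by linarith
qed

section \<open>Greedy colouring of the total graph\<close>

lemma total_graph_edge_simps:
  assumes "finite_simple_graph G"
  shows "{Inl u, Inl v} \<in> edges (total_graph G) \<longleftrightarrow> {u, v} \<in> edges G"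
    and "{Inl v, Inr e} \<in> edges (total_graph G) \<longleftrightarrow> e \<in> edges G \<and> v \<in> e"
    and "{Inr e, Inl v} \<in> edges (total_graph G) \<longleftrightarrow> e \<in> edges G \<and> v \<in> e"
    and "{Inr e, Inr e'} \<in> edges (total_graph G) \<longleftrightarrow>
      e \<in> edges G \<and> e' \<in> edges G \<and> e \<noteq> e' \<and> e \<inter> e' \<noteq> {}"
  unfolding total_graph_def by (auto simp: doubleton_eq_iff insert_commute Int_commute)

text \<open>Each neighbour \<open>y\<close> rules out at most one colour of \<open>A\<close>, so
  fewer neighbours than colours leave a free one. In a group, cancellation provides the
  uniqueness.\<close>

lemma avoid_conflicts:
  assumes "finite N" "finite A" "card N < card A"
    and uniq: "\<And>y a a'. y \<in> N \<Longrightarrow> a \<in> A \<Longrightarrow> a' \<in> A \<Longrightarrow> P y a \<Longrightarrow> P y a' \<Longrightarrow> a = a'"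
  obtains a where "a \<in> A" "\<And>y. y \<in> N \<Longrightarrow> \<not> P y a"
proof -
  let ?B = "\<Union>y \<in> N. {a \<in> A. P y a}"
  have "card {a \<in> A. P y a} \<le> 1" if "y \<in> N" for y
    using uniq[OF that] assms(2) by (simp add: card_le_Suc0_iff_eq)
  then have "card ?B \<le> card N"
    using card_UN_le[OF assms(1), of "\<lambda>y. {a \<in> A. P y a}"] sum_mono[of N "\<lambda>y. card {a \<in> A. P y a}" "\<lambda>_. 1"]
    by simp
  then have "\<not> A \<subseteq> ?B" using card_mono[of ?B A] assms by auto
  then show ?thesis using that by blast
qed

lemma card_neighbours:
  assumes "finite (edges G)"
  shows "finite {w. {u, w} \<in> edges G}" "card {w. {u, w} \<in> edges G} \<le> degree G u"
proof -
  have inj: "inj_on (\<lambda>w. {u, w}) {w. {u, w} \<in> edges G}" by (auto simp: inj_on_def doubleton_eq_iff)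
  have im: "(\<lambda>w. {u, w}) ` {w. {u, w} \<in> edges G} \<subseteq> {e \<in> edges G. u \<in> e}" by auto
  have fin: "finite {e \<in> edges G. u \<in> e}" using assms by simp
  show "finite {w. {u, w} \<in> edges G}" using inj_on_finite[OF inj im fin] .
  show "card {w. {u, w} \<in> edges G} \<le> degree G u" using card_inj_on_le[OF inj im fin] by (simp add: degree_def)
qed

text \<open>\<open>P x y a b\<close> says that the colours \<open>a\<close> at \<open>x\<close> and \<open>b\<close> at \<open>y\<close> are incompatible. The ends of a light
  edge \<open>{u, v}\<close> may receive incompatible colours when the edge is removed, so \<open>u\<close> is recoloured last.\<close>

lemma total_graph_colouring:
  fixes G :: "'a ugraph" and P :: "'a + 'a set \<Rightarrow> 'a + 'a set \<Rightarrow> 'g \<Rightarrow> 'g \<Rightarrow> bool"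
  assumes "finite_simple_graph G" "planar G" "\<not> has_cycle_of_length G 4" "\<not> has_cycle_of_length G 5"
    and "\<And>v. v \<in> vertices G \<Longrightarrow> degree G v \<le> k" and k: "5 \<le> k"
    and sym: "\<And>x y a b. P x y a b \<longleftrightarrow> P y x b a"
    and uniq: "\<And>x y a a' b. a \<in> C \<Longrightarrow> a' \<in> C \<Longrightarrow> b \<in> C \<Longrightarrow> P x y a b \<Longrightarrow> P x y a' b \<Longrightarrow> a = a'"
    and "\<And>x. x \<in> vertices (total_graph G) \<Longrightarrow> L x \<subseteq> C \<and> finite (L x) \<and> card (L x) = k + 2"
  shows "\<exists>c. (\<forall>x \<in> vertices (total_graph G). c x \<in> L x) \<and>
    (\<forall>x y. {x, y} \<in> edges (total_graph G) \<longrightarrow> \<not> P x y (c x) (c y))"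
  using assms(1-5,9)
proof (induction "card (edges G)" arbitrary: G rule: less_induct)
  case less
  note G = less.prems(1-4) and deg = less.prems(5) and L = less.prems(6)
  have fin: "finite (vertices G)" and E: "\<And>e. e \<in> edges G \<Longrightarrow> e \<subseteq> vertices G \<and> card e = 2"
    using G(1) by (auto simp: finite_simple_graph_def)
  have fE: "finite (edges G)" by (rule finite_subset[of _ "Pow (vertices G)"]) (use E fin in auto)
  show ?case
  proof (cases "edges G = {}")
    case True
    have "\<exists>a. a \<in> L x" if "x \<in> vertices (total_graph G)" for x
      using L[OF that] by (metis card.empty add_is_0 ex_in_conv zero_neq_numeral)
    then have "\<forall>x \<in> vertices (total_graph G). (SOME a. a \<in> L x) \<in> L x" by (meson someI_ex)
    moreover have "edges (total_graph G) = {}" using True by (simp add: total_graph_def)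
    ultimately show ?thesis by (intro exI[of _ "\<lambda>x. SOME a. a \<in> L x"]) simp
  next
    case False
    obtain u v where uv: "{u, v} \<in> edges G" and du: "degree G u \<le> 3" and duv: "degree G u + degree G v \<le> k + 2"
      using light_edge[OF G False deg k] by blast
    let ?e = "{u, v}"
    have "u \<noteq> v" using E[OF uv] by auto
    have V: "u \<in> vertices G" "v \<in> vertices G" using E[OF uv] by auto
    define G' where "G' = \<lparr>vertices = vertices G, edges = edges G - {?e}\<rparr>"
    have sub: "vertices G' \<subseteq> vertices G" "edges G' \<subseteq> edges G" by (auto simp: G'_def)
    have fG': "finite_simple_graph G'" using G(1) by (auto simp: G'_def finite_simple_graph_def)
    have deg': "degree G' w \<le> k" if "w \<in> vertices G'" for w
    proof -
      have "degree G' w \<le> degree G w" unfolding degree_def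
        by (rule card_mono) (use fE sub in auto)
      then show ?thesis using deg[of w] that sub by auto
    qed
    have vT: "vertices (total_graph G) = insert (Inr ?e) (vertices (total_graph G'))"
      using uv by (auto simp: total_graph_def G'_def)
    have "card (edges G') < card (edges G)" using card_Diff1_less[OF fE uv] by (simp add: G'_def)
    then have "\<exists>c. (\<forall>x \<in> vertices (total_graph G'). c x \<in> L x) \<and>
      (\<forall>x y. {x, y} \<in> edges (total_graph G') \<longrightarrow> \<not> P x y (c x) (c y))"
      by (rule less.hyps[OF _ fG' planar_subgraph[OF G(2) sub fG']])
        (use has_cycle_subgraph[OF sub] G(3,4) deg' L vT in auto)
    then obtain c where c: "\<And>x. x \<in> vertices (total_graph G') \<Longrightarrow> c x \<in> L x"
      and cP: "\<And>x y. {x, y} \<in> edges (total_graph G') \<Longrightarrow> \<not> P x y (c x) (c y)" by blast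
    define Du where "Du w = {e \<in> edges G. w \<in> e}" for w
    have fD: "finite (Du w)" and cD: "card (Du w) = degree G w" for w
      using fE by (simp_all add: Du_def degree_def)
    have eD: "?e \<in> Du u" "?e \<in> Du v" using uv by (auto simp: Du_def)
    \<comment> \<open>The neighbours of the edge \<open>{u, v}\<close> in the total graph except
      \<open>u\<close>: the vertex \<open>v\<close> and the other edges at either end, at most
      \<open>1 + (d(u) - 1) + (d(v) - 1) \<le> k + 1\<close>.\<close>
    define Ne where "Ne = insert (Inl v) (Inr ` (Du u - {?e} \<union> (Du v - {?e})))"
    have fNe: "finite Ne" using fD by (simp add: Ne_def)
    have "card (Du u - {?e} \<union> (Du v - {?e})) \<le> (degree G u - 1) + (degree G v - 1)"
      using card_Un_le[of "Du u - {?e}" "Du v - {?e}"] fD eD by (simp add: cD)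
    moreover have "0 < degree G u" "0 < degree G v"
      using eD fD cD by (metis card_gt_0_iff empty_iff)+
    moreover have "card Ne \<le> Suc (card (Du u - {?e} \<union> (Du v - {?e})))"
      unfolding Ne_def using fD by (intro order_trans[OF card_insert_le_m1]) (auto intro: card_image_le)
    ultimately have cNe: "card Ne < k + 2" using duv by linarith
    have NeV: "x \<in> vertices (total_graph G')" if "x \<in> Ne" for x
      using that V by (auto simp: Ne_def Du_def total_graph_def G'_def)
    have Le: "Inr ?e \<in> vertices (total_graph G)" using uv by (auto simp: total_graph_def)
    obtain \<alpha> where \<alpha>: "\<alpha> \<in> L (Inr ?e)" "\<And>y. y \<in> Ne \<Longrightarrow> \<not> P (Inr ?e) y \<alpha> (c y)"
    proof (rule avoid_conflicts[OF fNe, of "L (Inr ?e)" "\<lambda>y a. P (Inr ?e) y a (c y)"])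
      fix y a a' assume "y \<in> Ne" "a \<in> L (Inr ?e)" "a' \<in> L (Inr ?e)"
        "P (Inr ?e) y a (c y)" "P (Inr ?e) y a' (c y)"
      then show "a = a'" using uniq[of a a' "c y"] L[OF Le] L[of y] c[of y] NeV vT by blast
    qed (use L[OF Le] cNe in auto)
    define c1 where "c1 = c(Inr ?e := \<alpha>)"
    have c1: "c1 x \<in> L x" if "x \<in> vertices (total_graph G)" for x
      using that c \<alpha>(1) vT by (auto simp: c1_def)
    \<comment> \<open>All neighbours of \<open>u\<close>: at most 3 vertices and 3 edges, and 6 is
      less than \<open>k + 2\<close>.\<close>
    define Nu where "Nu = Inl ` {w. {u, w} \<in> edges G} \<union> Inr ` Du u"
    have fNu: "finite Nu" using card_neighbours(1)[OF fE] fD by (simp add: Nu_def)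
    have "card Nu \<le> degree G u + degree G u"
      unfolding Nu_def using card_neighbours[OF fE, of u] fD[of u] cD[of u]
      by (intro order_trans[OF card_Un_le] add_mono) (auto intro: order_trans[OF card_image_le])
    then have cNu: "card Nu < k + 2" using du k by linarith
    have NuV: "x \<in> vertices (total_graph G)" if "x \<in> Nu" for x
      using that E by (auto simp: Nu_def Du_def total_graph_def)
    have Lu: "Inl u \<in> vertices (total_graph G)" using V by (auto simp: total_graph_def)
    obtain \<beta> where \<beta>: "\<beta> \<in> L (Inl u)" "\<And>y. y \<in> Nu \<Longrightarrow> \<not> P (Inl u) y \<beta> (c1 y)"
    proof (rule avoid_conflicts[OF fNu, of "L (Inl u)" "\<lambda>y a. P (Inl u) y a (c1 y)"])
      fix y a a' assume "y \<in> Nu" "a \<in> L (Inl u)" "a' \<in> L (Inl u)"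
        "P (Inl u) y a (c1 y)" "P (Inl u) y a' (c1 y)"
      then show "a = a'" using uniq[of a a' "c1 y"] L[OF Lu] L[of y] c1[of y] NuV by blast
    qed (use L[OF Lu] cNu in auto)
    define c2 where "c2 = c1(Inl u := \<beta>)"
    have "c2 x \<in> L x" if "x \<in> vertices (total_graph G)" for x
      using that c1 \<beta>(1) by (auto simp: c2_def)
    moreover have "\<not> P x y (c2 x) (c2 y)" if xy: "{x, y} \<in> edges (total_graph G)" for x y
    proof -
      note adj = total_graph_edge_simps[OF G(1)]
      have no_loop: "{w, w} \<notin> edges G" for w using E[of "{w, w}"] by auto
      have u: "y \<in> Nu \<and> y \<noteq> Inl u" if "{Inl u, y} \<in> edges (total_graph G)" for y
        using that adj no_loop by (cases y) (auto simp: Nu_def Du_def)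
      have e: "y \<in> Ne \<and> y \<noteq> Inr ?e" if "{Inr ?e, y} \<in> edges (total_graph G)" "y \<noteq> Inl u" for y
        using that adj by (cases y) (auto simp: Ne_def Du_def)
      \<comment> \<open>Removing \<open>{u, v}\<close> destroys only the adjacencies of this edge
        and the one between \<open>u\<close> and \<open>v\<close>, so adjacent pairs avoiding both
        \<open>u\<close> and the edge are already compatible under \<open>c\<close>.\<close>
      have rest: "{x, y} \<in> edges (total_graph G')"
        if "x \<noteq> Inl u" "y \<noteq> Inl u" "x \<noteq> Inr ?e" "y \<noteq> Inr ?e"
        using xy that total_graph_edge_simps[OF fG'] adj
        by (cases x; cases y) (auto simp: G'_def doubleton_eq_iff)
      have yx: "{y, x} \<in> edges (total_graph G)" using xy by (simp add: insert_commute)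
      consider "x = Inl u" | "y = Inl u" | "x \<noteq> Inl u" "y \<noteq> Inl u" "x = Inr ?e"
        | "x \<noteq> Inl u" "y \<noteq> Inl u" "y = Inr ?e"
        | "x \<noteq> Inl u" "y \<noteq> Inl u" "x \<noteq> Inr ?e" "y \<noteq> Inr ?e" by blast
      then show ?thesis
      proof cases
        case 1
        then show ?thesis using u[of y] xy \<beta>(2)[of y] by (simp add: c2_def)
      next
        case 2
        then show ?thesis using u[of x] yx \<beta>(2)[of x] sym[of x y] by (simp add: c2_def)
      next
        case 3
        then show ?thesis using e[of y] xy \<alpha>(2)[of y] by (simp add: c2_def c1_def)
      next
        case 4
        then show ?thesis using e[of x] yx \<alpha>(2)[of x] sym[of x y] by (simp add: c2_def c1_def)
      next
        case 5
        then show ?thesis using cP[OF rest] by (simp add: c2_def c1_def)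
      qed
    qed
    ultimately show ?thesis by blast
  qed
qed

section \<open>Group colourings as colourings without conflicts\<close>

theorem theorem13:
  fixes G :: "'a ugraph" and k :: nat
  assumes "5 \<le> k"
    and "finite_simple_graph G"
    and "planar G"
    and "max_degree G \<le> k"
    and "\<not> has_cycle_of_length G 4"
    and "\<not> has_cycle_of_length G 5"
  shows "total_group_choice_number TYPE('g) G \<le> enat (k + 2)"
  unfolding total_group_choice_number_def group_choice_number_le_iff group_choosable_def
proof (intro allI impI, elim conjE)
  fix A :: "'g monoid" and D L f
  assume A: "group A" and D: "orientation (total_graph G) D"
    and L: "\<forall>v \<in> vertices (total_graph G). L v \<subseteq> carrier A \<and> finite (L v) \<and> card (L v) = k + 2"
  interpret group A by (fact A)
  \<comment> \<open>The orientation is absorbed into a relation that is symmetric under exchange of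
    the two vertices together with their colours.\<close>
  define P where "P x y a b \<longleftrightarrow> (x, y) \<in> D \<and> a \<otimes>\<^bsub>A\<^esub> inv\<^bsub>A\<^esub> b = f {x, y} \<or>
    (y, x) \<in> D \<and> b \<otimes>\<^bsub>A\<^esub> inv\<^bsub>A\<^esub> a = f {x, y}" for x y a b
  have "finite (vertices G)" using assms(2) by (simp add: finite_simple_graph_def)
  \<comment> \<open>Finiteness of the vertex set bounds the family of degrees, so the supremum on
    \<open>nat\<close> is an upper bound.\<close>
  then have deg: "degree G v \<le> k" if "v \<in> vertices G" for v
    using cSUP_upper[OF that, of "degree G"] assms(4) unfolding max_degree_def by simp
  have P_sym: "P x y a b \<longleftrightarrow> P y x b a" for x y a b
    unfolding P_def by (auto simp: insert_commute)
  have uniq: "a = a'" if "a \<in> carrier A" "a' \<in> carrier A" "b \<in> carrier A" "P x y a b" "P x y a' b" for x y a a' b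
  proof -
    \<comment> \<open>Only one direction is present, so the same disjunct holds for \<open>a\<close>
      and \<open>a'\<close>; cancellation on the right, or on the left followed by inversion, works
      in noncommutative groups too.\<close>
    have "\<not> ((x, y) \<in> D \<and> (y, x) \<in> D)" using D unfolding orientation_def by blast
    then have "a \<otimes>\<^bsub>A\<^esub> inv\<^bsub>A\<^esub> b = a' \<otimes>\<^bsub>A\<^esub> inv\<^bsub>A\<^esub> b \<or> b \<otimes>\<^bsub>A\<^esub> inv\<^bsub>A\<^esub> a = b \<otimes>\<^bsub>A\<^esub> inv\<^bsub>A\<^esub> a'"
      using that(4,5) unfolding P_def by metis
    then show ?thesis using that(1-3) by (metis Units_eq Units_l_cancel inv_closed inv_inv right_cancel)
  qed
  have "\<exists>c. (\<forall>x \<in> vertices (total_graph G). c x \<in> L x) \<and>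
    (\<forall>x y. {x, y} \<in> edges (total_graph G) \<longrightarrow> \<not> P x y (c x) (c y))"
  proof (rule total_graph_colouring[where C = "carrier A", OF assms(2,3,5,6) deg assms(1) P_sym])
    show "a = a'" if "a \<in> carrier A" "a' \<in> carrier A" "b \<in> carrier A" "P x y a b" "P x y a' b" for x y a a' b
      by (rule uniq[OF that])
    show "L x \<subseteq> carrier A \<and> finite (L x) \<and> card (L x) = k + 2" if "x \<in> vertices (total_graph G)" for x
      using L that by blast
  qed
  then obtain c where c: "\<forall>x \<in> vertices (total_graph G). c x \<in> L x"
    "\<forall>x y. {x, y} \<in> edges (total_graph G) \<longrightarrow> \<not> P x y (c x) (c y)" by blast
  have "group_coloring (total_graph G) D A L f c"
    using c L D unfolding group_coloring_def orientation_def P_def by fast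
  then show "\<exists>c. group_coloring (total_graph G) D A L f c" by blast
qed

end
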